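(* Let $d\ge 1$ and let $Y$ be an effective $\mathbb Z^d$-subshift which is not an SFT. Then the problem "$X\subseteq Y$ on effective inputs $X$" is $\Pi^0_2$-complete.
   Context: For a finite alphabet $\mathcal A$ (a finite subset of $\mathbb N$), a pattern is a function $p\colon S\to\mathcal A$ with $S\subset\mathbb Z^d$ finite; it appears in $x\in\mathcal A^{\mathbb Z^d}$ if there is $u\in\mathbb Z^d$ with $x(u+s)=p(s)$ for all $s\in S$. For a set $\mathcal F$ of patterns, $X_{\mathcal F}$ is the set of configurations in which no pattern from $\mathcal F$ appears. A subshift is a set of the form $X_{\mathcal F}$ (possibly empty); it is an SFT if $\mathcal F$ can be taken finite, and effective if $\mathcal F$ can be taken recursively enumerable. The subshift $Y$ is a fixed parameter. "The problem $X\subseteq Y$ on effective inputs" is: given an effective $\mathbb Z^d$-subshift $X$, specified by an alphabet and a Turing machine enumerating a defining set of forbidden patterns, determine whether $X\subseteq Y$. Completeness is with respect to many-one reductions. *)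

theory Defs
  imports Complex_Main "HOL-Library.FuncSet" "HOL-Library.Nat_Bijection"
begin

section \<open>Turing machines\<close>

text \<open>
  Deterministic machines with one two-way infinite tape. States and tape symbols are natural
  numbers, of which a given machine mentions only finitely many; \<open>0\<close> is the start state and the
  blank symbol. A machine is its finite transition table
  \<open>((state, symbol read), (new state, symbol written, direction))\<close>. It halts when no entry applies.
  If several entries have the same left-hand side, the first one is used, so every table
  describes a deterministic machine.
\<close>

datatype direction = MoveL | MoveR

type_synonym tm = "((nat \<times> nat) \<times> (nat \<times> nat \<times> direction)) list"

text \<open>
  A configuration \<open>(q, ls, rs)\<close> has state \<open>q\<close>; \<open>rs\<close> lists the cells from the scanned one to the
  right and \<open>ls\<close> the cells to its left, nearest first. All cells not listed are blank.
\<close>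

type_synonym tm_config = "nat \<times> nat list \<times> nat list"

fun scanned :: "nat list \<Rightarrow> nat" where
  "scanned [] = 0"
| "scanned (a # rs) = a"

fun tm_move :: "direction \<Rightarrow> nat list \<Rightarrow> nat list \<Rightarrow> nat list \<times> nat list" where
  "tm_move MoveL [] rs = ([], 0 # rs)"
| "tm_move MoveL (a # ls) rs = (ls, a # rs)"
| "tm_move MoveR ls [] = (0 # ls, [])"
| "tm_move MoveR ls (a # rs) = (a # ls, rs)"

fun tm_next :: "tm \<Rightarrow> tm_config \<Rightarrow> tm_config option" where
  "tm_next M (q, ls, rs) =
     (case map_of M (q, scanned rs) of
        None \<Rightarrow> None
      | Some (q', b, D) \<Rightarrow> Some (q', tm_move D ls (b # tl rs)))"

definition tm_reaches :: "tm \<Rightarrow> tm_config \<Rightarrow> tm_config \<Rightarrow> bool" where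
  "tm_reaches M = (\<lambda>c c'. tm_next M c = Some c')\<^sup>*\<^sup>*"

text \<open>
  Input and output are unary: on input \<open>n\<close> the machine starts on the leftmost of \<open>n\<close> ones on an
  otherwise blank tape, and the output of a halting run is the length of the block of ones that
  starts at the scanned cell.
\<close>

definition tm_outputs :: "tm \<Rightarrow> nat \<Rightarrow> nat \<Rightarrow> bool" where
  "tm_outputs M n m \<longleftrightarrow>
     (\<exists>q ls rs. tm_reaches M (0, [], replicate n 1) (q, ls, rs) \<and>
        tm_next M (q, ls, rs) = None \<and> m = length (takeWhile (\<lambda>a. a = 1) rs))"

text \<open>
  The set of numbers enumerated by a machine: its outputs over all inputs on which it halts.
\<close>

definition tm_range :: "tm \<Rightarrow> nat set" where
  "tm_range M = {m. \<exists>n. tm_outputs M n m}"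


section \<open>Computability and the class \<open>\<Pi>\<^sup>0\<^sub>2\<close>\<close>

definition computable :: "(nat \<Rightarrow> nat) \<Rightarrow> bool" where
  "computable f \<longleftrightarrow> (\<exists>M. \<forall>n. tm_outputs M n (f n))"

definition decidable :: "nat set \<Rightarrow> bool" where
  "decidable P \<longleftrightarrow> computable (\<lambda>n. if n \<in> P then 1 else 0)"

definition Pi02 :: "nat set \<Rightarrow> bool" where
  "Pi02 P \<longleftrightarrow>
     (\<exists>R. decidable R \<and>
        (\<forall>x. x \<in> P \<longleftrightarrow> (\<forall>y. \<exists>z. prod_encode (x, prod_encode (y, z)) \<in> R)))"

definition many_one_reducible :: "nat set \<Rightarrow> nat set \<Rightarrow> bool" where
  "many_one_reducible P Q \<longleftrightarrow> (\<exists>f. computable f \<and> (\<forall>x. x \<in> P \<longleftrightarrow> f x \<in> Q))"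

definition Pi02_complete :: "nat set \<Rightarrow> bool" where
  "Pi02_complete P \<longleftrightarrow> Pi02 P \<and> (\<forall>Q. Pi02 Q \<longrightarrow> many_one_reducible Q P)"


section \<open>Subshifts\<close>

text \<open>
  The group \<open>\<int>\<^sup>d\<close> is represented by the integer lists of length \<open>d\<close>, and configurations over
  \<open>A\<close> by the functions from it to \<open>A\<close> that are \<open>undefined\<close> elsewhere. A pattern is a finite
  partial function.
\<close>

type_synonym vec = "int list"
type_synonym configuration = "vec \<Rightarrow> nat"
type_synonym pattern = "vec \<rightharpoonup> nat"

definition Zd :: "nat \<Rightarrow> vec set" where
  "Zd d = {v. length v = d}"

definition vec_add :: "vec \<Rightarrow> vec \<Rightarrow> vec" where
  "vec_add u v = map2 (+) u v"

definition configurations :: "nat \<Rightarrow> nat set \<Rightarrow> configuration set" where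
  "configurations d A = Zd d \<rightarrow>\<^sub>E A"

definition patterns :: "nat \<Rightarrow> nat set \<Rightarrow> pattern set" where
  "patterns d A = {p. finite (dom p) \<and> dom p \<subseteq> Zd d \<and> ran p \<subseteq> A}"

definition appears :: "nat \<Rightarrow> pattern \<Rightarrow> configuration \<Rightarrow> bool" where
  "appears d p x \<longleftrightarrow> (\<exists>u\<in>Zd d. \<forall>s\<in>dom p. p s = Some (x (vec_add u s)))"

definition subshift :: "nat \<Rightarrow> nat set \<Rightarrow> pattern set \<Rightarrow> configuration set" where
  "subshift d A F = {x \<in> configurations d A. \<forall>p\<in>F. \<not> appears d p x}"

definition SFT :: "nat \<Rightarrow> configuration set \<Rightarrow> bool" where
  "SFT d X \<longleftrightarrow> (\<exists>A F. finite A \<and> F \<subseteq> patterns d A \<and> finite F \<and> X = subshift d A F)"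

text \<open>
  A number codes a pattern through the list of its \<open>(position, symbol)\<close> pairs, in any order;
  if a position is repeated, its first occurrence counts.
\<close>

definition pattern_of :: "nat \<Rightarrow> pattern" where
  "pattern_of n =
     map_of (map (\<lambda>e. case prod_decode e of (v, a) \<Rightarrow> (map int_decode (list_decode v), a))
                 (list_decode n))"

text \<open>
  The set of patterns over \<open>A\<close> enumerated by a machine. Outputs that do not code a pattern over
  \<open>A\<close> on \<open>\<int>\<^sup>d\<close> are ignored, so that every machine enumerates such a set.
\<close>

definition enumerated_patterns :: "nat \<Rightarrow> nat set \<Rightarrow> tm \<Rightarrow> pattern set" where
  "enumerated_patterns d A M = pattern_of ` tm_range M \<inter> patterns d A"

definition effective_subshift :: "nat \<Rightarrow> configuration set \<Rightarrow> bool" where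
  "effective_subshift d X \<longleftrightarrow>
     (\<exists>A F. finite A \<and> F \<subseteq> patterns d A \<and> (\<exists>M. F = enumerated_patterns d A M) \<and>
        X = subshift d A F)"


section \<open>The inclusion problem\<close>

definition direction_encode :: "direction \<Rightarrow> nat" where
  "direction_encode D = (case D of MoveL \<Rightarrow> 0 | MoveR \<Rightarrow> 1)"

definition tm_encode :: "tm \<Rightarrow> nat" where
  "tm_encode M =
     list_encode
       (map (\<lambda>((q, a), (q', b, D)).
               prod_encode (prod_encode (q, a),
                 prod_encode (q', prod_encode (b, direction_encode D)))) M)"

definition instance_encode :: "nat set \<Rightarrow> tm \<Rightarrow> nat" where
  "instance_encode A M = prod_encode (set_encode A, tm_encode M)"

definition inclusion_problem :: "nat \<Rightarrow> configuration set \<Rightarrow> nat set" where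
  "inclusion_problem d Y =
     {instance_encode A M | A M. finite A \<and> subshift d A (enumerated_patterns d A M) \<subseteq> Y}"


section \<open>The codings are adequate\<close>

lemma inj_tm_encode: "inj tm_encode"
proof -
  have "inj (\<lambda>((q, a), (q', b, D)).
               prod_encode (prod_encode (q, a),
                 prod_encode (q', prod_encode (b, direction_encode D))))"
    by (auto simp: inj_def direction_encode_def split: direction.splits)
  then have "inj (map (\<lambda>((q, a), (q', b, D)).
               prod_encode (prod_encode (q, a),
                 prod_encode (q', prod_encode (b, direction_encode D)))))"
    by (rule inj_mapI)
  then show ?thesis
    unfolding tm_encode_def inj_def by (simp add: list_encode_eq)
qed

lemma instance_encode_eq_iff:
  assumes "finite A" and "finite B"
  shows "instance_encode A M = instance_encode B N \<longleftrightarrow> A = B \<and> M = N"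
  using assms inj_tm_encode
  by (auto simp: instance_encode_def set_encode_eq dest: injD)

lemma instance_encode_in_inclusion_problem_iff:
  assumes "finite A"
  shows "instance_encode A M \<in> inclusion_problem d Y \<longleftrightarrow>
           subshift d A (enumerated_patterns d A M) \<subseteq> Y"
  using assms by (auto simp: inclusion_problem_def instance_encode_eq_iff)

lemma pattern_of_surj:
  assumes "p \<in> patterns d A"
  shows "\<exists>n. pattern_of n = p"
proof -
  have "finite (Map.graph p)"
    using assms by (simp add: patterns_def)
  then obtain xs where xs: "set xs = fst ` Map.graph p" and "distinct xs"
    using finite_distinct_list[of "fst ` Map.graph p"] by blast
  define ys where "ys = map (\<lambda>v. (v, the (p v))) xs"
  have dom: "set xs = dom p"
    using xs by (simp add: fst_graph_eq_dom)
  have "map_of ys = p"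
    unfolding ys_def using dom
    by (auto simp: map_of_map_restrict restrict_map_def fun_eq_iff domIff dest: sym)
  define n where
    "n = list_encode (map (\<lambda>(v, a). prod_encode (list_encode (map int_encode v), a)) ys)"
  have "pattern_of n = map_of ys"
    by (simp add: pattern_of_def n_def comp_def case_prod_unfold)
  with \<open>map_of ys = p\<close> show ?thesis by blast
qed

end

theory Submission
  imports Defs "HOL-Library.More_List"
begin

text \<open>
  Upper bound: \<open>X \<subseteq> Y\<close> holds iff every forbidden pattern of \<open>Y\<close> over the alphabet of \<open>X\<close>, and every
  symbol of \<open>X\<close> that is foreign to \<open>Y\<close>, appears in no configuration of \<open>X\<close>. By compactness
  non-appearance is witnessed by a finite derivation, which gives a \<open>\<forall>\<exists>\<close> statement.

  Hardness: let \<open>x \<in> Q\<close> iff \<open>\<forall>y. \<exists>z. R x y z\<close>. The machine \<open>M\<^sub>x\<close> outputs the \<open>i\<close>-th forbidden pattern of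
  \<open>Y\<close> once it has found some \<open>z\<close> with \<open>R x y z\<close> for each \<open>y \<le> i\<close>. If \<open>x \<in> Q\<close> it enumerates all of them
  and defines \<open>Y\<close>; otherwise it enumerates finitely many and defines an SFT containing \<open>Y\<close>, which is
  not contained in \<open>Y\<close> since it would equal \<open>Y\<close>.

  With bounded simulation all functions involved are primitive recursive. These are computed
  by loop programs, which are compiled to Turing machines.
\<close>

section \<open>Runs of Turing machines\<close>

text \<open>The set enumerated by a machine consists of its outputs over all inputs. A time bound
  can therefore be made part of the input, and the machines built here never need an unbounded
  search; this is why loop programs suffice. Likewise, in the upper bound time bounds are quantified
  numbers, not loops.

  A reduction has to compute the table of \<open>M\<^sub>x\<close> from \<open>x\<close>, as the
  s-m-n theorem would provide. Here \<open>x\<close> enters the table of one fixed program only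
  through the length of a chain of states, so the table is visibly a primitive recursive function of
  \<open>x\<close>.

  In the hardness proof the index \<open>i\<close> is an input of the machine for \<open>Y\<close>,
  not a rank among its patterns. Each input yields at most one pattern, and a single
  \<open>y\<close> without a \<open>z\<close> blocks all \<open>i \<ge> y\<close>; hence the
  finiteness. In the upper bound the enumeration of \<open>Y\<close> supplies the universal
  quantifier and the derivations supply the existential one.\<close>

lemma tm_reaches_Suc:
  "tm_next M c = Some c' \<Longrightarrow> tm_reaches M c' c'' \<Longrightarrow> tm_reaches M c c''"
  unfolding tm_reaches_def by (rule converse_rtranclp_into_rtranclp)

lemma tm_reaches_halt_unique:
  assumes "tm_reaches M c d" "tm_next M d = None" "tm_reaches M c e" "tm_next M e = None"
  shows "d = e"
  using assms(1,3) unfolding tm_reaches_def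
proof (induction rule: converse_rtranclp_induct)
  case base
  then show ?case using assms(2) by (auto elim: converse_rtranclpE)
next
  case (step c c')
  from step.prems step.hyps(1) assms(4) have "(\<lambda>c c'. tm_next M c = Some c')\<^sup>*\<^sup>* c' e"
    by (auto elim: converse_rtranclpE)
  then show ?case by (rule step.IH)
qed

lemma tm_outputs_unique: "tm_outputs M n m \<Longrightarrow> tm_outputs M n m' \<Longrightarrow> m = m'"
  unfolding tm_outputs_def using tm_reaches_halt_unique by fastforce

text \<open>
  Runs are analysed with the tape as a function on absolute positions, which spares the
  case distinctions of the list representation.
\<close>

definition tape_rep :: "int \<Rightarrow> (int \<Rightarrow> nat) \<Rightarrow> nat list \<Rightarrow> nat list \<Rightarrow> bool" where
  "tape_rep p T ls rs \<longleftrightarrow>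
     (\<forall>i. T i = (if i < p then nth_default 0 ls (nat (p - 1 - i)) else nth_default 0 rs (nat (i - p))))"

definition abs_step :: "tm \<Rightarrow> nat \<times> int \<times> (int \<Rightarrow> nat) \<Rightarrow> nat \<times> int \<times> (int \<Rightarrow> nat) \<Rightarrow> bool" where
  "abs_step M = (\<lambda>(q, p, T) (q', p', T'). \<exists>b D. map_of M (q, T p) = Some (q', b, D) \<and>
     T' = T(p := b) \<and> p' = (case D of MoveL \<Rightarrow> p - 1 | MoveR \<Rightarrow> p + 1))"

lemma tape_rep_scanned: "tape_rep p T ls rs \<Longrightarrow> scanned rs = T p"
  unfolding tape_rep_def by (cases rs) (auto simp: nth_default_Cons_0)

lemma nth_default_Cons_nat:
  "nth_default d (x # xs) (nat k) = (if k \<le> 0 then x else nth_default d xs (nat (k - 1)))"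
proof (cases "k \<le> 0")
  case False
  then have "nat k = Suc (nat (k - 1))" by linarith
  with False show ?thesis by simp
qed simp

lemma nth_default_tl: "nth_default d (tl xs) k = nth_default d xs (Suc k)"
  by (cases xs) auto

lemma tape_rep_move:
  assumes "tape_rep p T ls rs" "tm_move D ls (b # tl rs) = (ls', rs')"
  shows "tape_rep (case D of MoveL \<Rightarrow> p - 1 | MoveR \<Rightarrow> p + 1) (T(p := b)) ls' rs'"
proof -
  have left: "nth_default 0 ls (nat (p - 1 - i)) = T i" if "i < p" for i
    using assms(1) that by (simp add: tape_rep_def)
  have right: "nth_default 0 (tl rs) (nat (i - p - 1)) = T i" if "p < i" for i
  proof -
    have "Suc (nat (i - p - 1)) = nat (i - p)" using that by linarith
    then show ?thesis using assms(1) that by (simp add: tape_rep_def nth_default_tl)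
  qed
  show ?thesis
  proof (cases D)
    case MoveL
    have ls': "nth_default 0 ls' (nat (p - 1 - 1 - i)) = T i" if "i < p - 1" for i
    proof -
      have e: "\<not> p - 1 - i \<le> 0" "p - 1 - i - 1 = p - 1 - 1 - i" using that by auto
      show ?thesis
        using left[of i] that assms(2) MoveL e
        by (cases ls) (auto simp only: nth_default_Cons_nat tm_move.simps nth_default_Nil if_False prod.inject)
    qed
    have rs': "rs' = T (p - 1) # b # tl rs"
      using left[of "p - 1"] assms(2) MoveL by (cases ls) auto
    show ?thesis
      unfolding tape_rep_def
    proof
      fix i
      consider "i < p - 1" | "i = p - 1" | "i = p" | "p < i" by linarith
      then show "(T(p := b)) i = (if i < (case D of MoveL \<Rightarrow> p - 1 | MoveR \<Rightarrow> p + 1)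
          then nth_default 0 ls' (nat ((case D of MoveL \<Rightarrow> p - 1 | MoveR \<Rightarrow> p + 1) - 1 - i))
          else nth_default 0 rs' (nat (i - (case D of MoveL \<Rightarrow> p - 1 | MoveR \<Rightarrow> p + 1))))"
      proof cases
        case 4
        then have "i - (p - 1) - 1 - 1 = i - p - 1" by simp
        with 4 show ?thesis using right[of i] MoveL by (simp add: rs' nth_default_Cons_nat)
      qed (use ls'[of i] MoveL in \<open>simp_all add: rs' nth_default_Cons_nat\<close>)
    qed
  next
    case MoveR
    then have ls': "ls' = b # ls" and rs': "rs' = tl rs" using assms(2) by auto
    show ?thesis
      unfolding tape_rep_def
    proof
      fix i
      consider "i < p" | "i = p" | "p < i" by linarith
      then show "(T(p := b)) i = (if i < (case D of MoveL \<Rightarrow> p - 1 | MoveR \<Rightarrow> p + 1)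
          then nth_default 0 ls' (nat ((case D of MoveL \<Rightarrow> p - 1 | MoveR \<Rightarrow> p + 1) - 1 - i))
          else nth_default 0 rs' (nat (i - (case D of MoveL \<Rightarrow> p - 1 | MoveR \<Rightarrow> p + 1))))"
      proof cases
        case 1
        then have "nth_default 0 ls (nat (p - i - 1)) = T i"
          using left[of i] by (simp only: diff_right_commute[of p 1 i])
        with 1 show ?thesis
          using MoveR by (simp add: ls' nth_default_Cons_nat)
      next
        case 3
        then show ?thesis using right[of i] MoveR by (simp add: rs' diff_diff_eq)
      qed (use MoveR in \<open>simp add: ls'\<close>)
    qed
  qed
qed

lemma abs_step_tm_next:
  assumes "abs_step M (q, p, T) (q', p', T')" "tape_rep p T ls rs"
  shows "\<exists>ls' rs'. tm_next M (q, ls, rs) = Some (q', ls', rs') \<and> tape_rep p' T' ls' rs'"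
proof -
  obtain b D where b: "map_of M (q, T p) = Some (q', b, D)" "T' = T(p := b)"
    "p' = (case D of MoveL \<Rightarrow> p - 1 | MoveR \<Rightarrow> p + 1)"
    using assms(1) by (auto simp: abs_step_def)
  obtain ls' rs' where m: "tm_move D ls (b # tl rs) = (ls', rs')" by fastforce
  show ?thesis
    using tape_rep_move[OF assms(2) m] b m tape_rep_scanned[OF assms(2)] by auto
qed

lemma abs_steps_tm_reaches:
  assumes "(abs_step M)\<^sup>*\<^sup>* C C'" "C = (q, p, T)" "C' = (q', p', T')" "tape_rep p T ls rs"
  shows "\<exists>ls' rs'. tm_reaches M (q, ls, rs) (q', ls', rs') \<and> tape_rep p' T' ls' rs'"
  using assms
proof (induction arbitrary: q p T ls rs rule: converse_rtranclp_induct)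
  case base
  then show ?case by (auto simp: tm_reaches_def)
next
  case (step C C1)
  obtain q1 p1 T1 where C1: "C1 = (q1, p1, T1)" by (cases C1) auto
  show ?case
    using abs_step_tm_next[of M q p T q1 p1 T1 ls rs] step.IH[OF C1] step.hyps step.prems C1
      tm_reaches_Suc by blast
qed

section \<open>Loop programs\<close>

datatype com = Skip | Inc nat | Seq com com | Loop nat com

primrec vars :: "com \<Rightarrow> nat set" where
  "vars Skip = {}"
| "vars (Inc r) = {r}"
| "vars (Seq c1 c2) = vars c1 \<union> vars c2"
| "vars (Loop r c) = insert r (vars c)"

primrec wf_com :: "com \<Rightarrow> bool" where
  "wf_com Skip = True"
| "wf_com (Inc r) = True"
| "wf_com (Seq c1 c2) = (wf_com c1 \<and> wf_com c2)"
| "wf_com (Loop r c) = (wf_com c \<and> r \<notin> vars c)"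

text \<open>
  \<open>Loop r c\<close> runs \<open>c\<close> as often as the value of \<open>r\<close> and clears \<open>r\<close>; this describes
  ``while \<open>r > 0\<close> decrement \<open>r\<close> and run \<open>c\<close>'' since \<open>c\<close> does not mention \<open>r\<close>.
\<close>

primrec exec :: "com \<Rightarrow> (nat \<Rightarrow> nat) \<Rightarrow> nat \<Rightarrow> nat" where
  "exec Skip s = s"
| "exec (Inc r) s = s(r := Suc (s r))"
| "exec (Seq c1 c2) s = exec c2 (exec c1 s)"
| "exec (Loop r c) s = (exec c ^^ s r) (s(r := 0))"

lemma finite_vars: "finite (vars c)"
  by (induction c) auto

text \<open>Frame property: a program neither reads nor writes a register that it does not
  mention.\<close>

lemma exec_fun_upd_fresh: "r \<notin> vars c \<Longrightarrow> exec c (s(r := v)) = (exec c s)(r := v)"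
proof (induction c arbitrary: s)
  case (Loop r' c)
  have "(exec c ^^ n) (s(r := v)) = ((exec c ^^ n) s)(r := v)" for n s
    using Loop by (induction n) auto
  moreover have "s(r := v, r' := 0) = s(r' := 0, r := v)" using Loop.prems by (auto simp: fun_upd_twist)
  ultimately show ?case using Loop.prems by (simp del: fun_upd_apply) simp
qed (auto simp: fun_upd_twist)

lemma exec_fresh: "r \<notin> vars c \<Longrightarrow> exec c s r = s r"
  using exec_fun_upd_fresh[of r c s "s r"] by (metis fun_upd_same fun_upd_triv)

text \<open>Bridges two views of a loop: \<open>exec\<close> clears the counter before all rounds,
  compiled code decrements it once per round. The body cannot tell the difference.\<close>

lemma exec_Loop_Suc:
  assumes "r \<notin> vars c" "s r = Suc k"
  shows "exec (Loop r c) s = exec (Loop r c) (exec c (s(r := k)))"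
  using assms by (simp add: exec_fresh exec_fun_upd_fresh[symmetric] funpow_swap1)

section \<open>Compilation of loop programs\<close>

text \<open>
  The registers \<open>r < K\<close> with values \<open>s r\<close> are kept in unary on \<open>K\<close> parallel tracks: cell
  \<open>p \<ge> 0\<close> holds the code of the set of all \<open>r\<close> with \<open>p < s r\<close>, and cell \<open>-1\<close> holds the
  marker \<open>2 ^ K\<close>. Compiled programs start and end in cell \<open>0\<close>.
\<close>

definition reg_tape :: "nat \<Rightarrow> (nat \<Rightarrow> nat) \<Rightarrow> int \<Rightarrow> nat" where
  "reg_tape K s p = (if p < - 1 then 0 else if p = - 1 then 2 ^ K
     else set_encode {r. r < K \<and> nat p < s r})"

text \<open>Return sweep to cell \<open>0\<close>. Codes of sets of tracks are below
  \<open>2 ^ K\<close>, so the marker stops it unambiguously.\<close>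

definition walk :: "nat \<Rightarrow> nat \<Rightarrow> nat \<Rightarrow> tm" where
  "walk K q q' = ((q, 2 ^ K), (q', 2 ^ K, MoveR)) # map (\<lambda>a. ((q, a), (q, a, MoveL))) [0..<2 ^ K]"

primrec com_size :: "com \<Rightarrow> nat" where
  "com_size Skip = 0"
| "com_size (Inc r) = 2"
| "com_size (Seq c1 c2) = com_size c1 + com_size c2"
| "com_size (Loop r c) = com_size c + 4"

text \<open>A unary track is a block starting at cell \<open>0\<close>, so a unit change of
  \<open>r\<close> touches one cell at the end of its block. Both \<open>Inc\<close> and
  \<open>Loop\<close> scan right to the first cell without \<open>r\<close>. \<open>Inc\<close> adds
  \<open>r\<close> there. \<open>Loop\<close> steps back once: on the marker it exits, otherwise it
  removes \<open>r\<close>, returns to cell \<open>0\<close>, runs the body and returns again. The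
  constants in \<open>com_size\<close> count these auxiliary states.\<close>

primrec compile :: "nat \<Rightarrow> com \<Rightarrow> nat \<Rightarrow> tm" where
  "compile K Skip q = []"
| "compile K (Inc r) q =
     map (\<lambda>a. ((q, a), if r \<in> set_decode a then (q, a, MoveR)
                 else (q + 1, set_encode (insert r (set_decode a)), MoveL))) [0..<2 ^ K] @
     walk K (q + 1) (q + 2)"
| "compile K (Seq c1 c2) q = compile K c1 q @ compile K c2 (q + com_size c1)"
| "compile K (Loop r c) q =
     map (\<lambda>a. ((q, a), if r \<in> set_decode a then (q, a, MoveR) else (q + 1, a, MoveL))) [0..<2 ^ K] @
     ((q + 1, 2 ^ K), (q + com_size c + 4, 2 ^ K, MoveR)) #
     map (\<lambda>a. ((q + 1, a), (q + 2, set_encode (set_decode a - {r}), MoveL))) [0..<2 ^ K] @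
     walk K (q + 2) (q + 3) @ compile K c (q + 3) @ walk K (q + com_size c + 3) q"

text \<open>Allows reasoning about a block inside any larger table: since \<open>map_of\<close>
  takes the first match, no entry of the block may be overridden there.\<close>

definition agrees :: "tm \<Rightarrow> tm \<Rightarrow> bool" where
  "agrees M N \<longleftrightarrow> (\<forall>(k, v) \<in> set N. map_of M k = Some v)"

lemma agrees_simps [simp]:
  "agrees M []"
  "agrees M ((k, v) # N) \<longleftrightarrow> map_of M k = Some v \<and> agrees M N"
  "agrees M (N1 @ N2) \<longleftrightarrow> agrees M N1 \<and> agrees M N2"
  by (auto simp: agrees_def)

lemma agrees_map_upt:
  "agrees M (map (\<lambda>a. (f a, g a)) [0..<n]) \<longleftrightarrow> (\<forall>a<n. map_of M (f a) = Some (g a))"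
  by (auto simp: agrees_def)

lemma agrees_distinct: "distinct (map fst M) \<Longrightarrow> set N \<subseteq> set M \<Longrightarrow> agrees M N"
  by (auto simp: agrees_def)

lemma set_encode_less:
  assumes "S \<subseteq> {..<K}"
  shows "set_encode S < 2 ^ K"
proof -
  have "set_encode S \<le> (\<Sum>r<K. 2 ^ r)"
    unfolding set_encode_def using assms by (intro sum_mono2) auto
  also have "\<dots> < 2 ^ K" by (induction K) auto
  finally show ?thesis .
qed

lemma reg_tape_marker [simp]: "reg_tape K s (- 1) = 2 ^ K"
  by (simp add: reg_tape_def)

lemma reg_tape_less: "0 \<le> p \<Longrightarrow> reg_tape K s p < 2 ^ K"
  unfolding reg_tape_def by (auto intro!: set_encode_less)

lemma set_decode_reg_tape: "0 \<le> p \<Longrightarrow> set_decode (reg_tape K s p) = {r. r < K \<and> nat p < s r}"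
  by (simp add: reg_tape_def)

lemma reg_tape_inc:
  assumes "r < K"
  shows "(reg_tape K s)(int (s r) := set_encode (insert r (set_decode (reg_tape K s (int (s r))))))
    = reg_tape K (s(r := Suc (s r)))"
proof
  fix p
  have "insert r {r'. r' < K \<and> s r < s r'} = {r'. r' < K \<and> s r < (s(r := Suc (s r))) r'}"
    using assms by auto
  moreover have "{r'. r' < K \<and> nat p < s r'} = {r'. r' < K \<and> nat p < (s(r := Suc (s r))) r'}"
    if "nat p \<noteq> s r" using that by auto
  ultimately show "((reg_tape K s)(int (s r) := set_encode (insert r (set_decode (reg_tape K s (int (s r))))))) p
    = reg_tape K (s(r := Suc (s r))) p"
    by (cases "0 \<le> p") (auto simp: set_decode_reg_tape reg_tape_def)
qed

lemma reg_tape_dec: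
  assumes "s r = Suc k"
  shows "(reg_tape K s)(int k := set_encode (set_decode (reg_tape K s (int k)) - {r}))
    = reg_tape K (s(r := k))"
proof
  fix p
  have "{r'. r' < K \<and> k < s r'} - {r} = {r'. r' < K \<and> k < (s(r := k)) r'}" by auto
  moreover have "{r'. r' < K \<and> nat p < s r'} = {r'. r' < K \<and> nat p < (s(r := k)) r'}"
    if "nat p \<noteq> k" using that assms by auto
  ultimately show "((reg_tape K s)(int k := set_encode (set_decode (reg_tape K s (int k)) - {r}))) p
    = reg_tape K (s(r := k)) p"
    by (cases "0 \<le> p") (auto simp: set_decode_reg_tape reg_tape_def)
qed

lemma abs_stepI:
  "map_of M (q, T p) = Some (q', b, D) \<Longrightarrow> T' = T(p := b) \<Longrightarrow>
   p' = (case D of MoveL \<Rightarrow> p - 1 | MoveR \<Rightarrow> p + 1) \<Longrightarrow> abs_step M (q, p, T) (q', p', T')"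
  by (auto simp: abs_step_def)

text \<open>The start \<open>p = - 1\<close> does occur: after a zero register is incremented, the
  head has stepped from cell \<open>0\<close> onto the marker.\<close>

lemma walk_left:
  assumes "agrees M (walk K q q')" "T (- 1) = 2 ^ K" "\<And>p. 0 \<le> p \<Longrightarrow> T p < 2 ^ K"
  shows "- 1 \<le> p \<Longrightarrow> (abs_step M)\<^sup>*\<^sup>* (q, p, T) (q', 0, T)"
proof (induction "nat (p + 1)" arbitrary: p)
  case 0
  then have "p = - 1" by simp
  then have "abs_step M (q, p, T) (q', 0, T)"
    using assms(1,2) by (intro abs_stepI[of _ _ _ _ _ "2 ^ K" MoveR]) (auto simp: walk_def)
  then show ?case by blast
next
  case (Suc n)
  then have p: "0 \<le> p" by linarith
  have "abs_step M (q, p, T) (q, p - 1, T)"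
    using assms(1) assms(3)[OF p]
    by (intro abs_stepI[of _ _ _ _ _ "T p" MoveL]) (auto simp: walk_def agrees_map_upt)
  moreover have "(abs_step M)\<^sup>*\<^sup>* (q, p - 1, T) (q', 0, T)"
    using Suc.hyps(2) p by (intro Suc.hyps(1)) auto
  ultimately show ?case by (rule converse_rtranclp_into_rtranclp)
qed

lemma walk_right:
  assumes "\<And>j. j < n \<Longrightarrow> abs_step M (q, int j, T) (q, int j + 1, T)"
  shows "(abs_step M)\<^sup>*\<^sup>* (q, 0, T) (q, int n, T)"
  using assms
proof (induction n)
  case (Suc n)
  have "(abs_step M)\<^sup>*\<^sup>* (q, 0, T) (q, int n, T)" using Suc by simp
  moreover have "abs_step M (q, int n, T) (q, int n + 1, T)" using Suc.prems by simp
  ultimately show ?case by (simp add: add.commute)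
qed simp

lemma compile_correct:
  assumes "wf_com c" "vars c \<subseteq> {..<K}" "agrees M (compile K c q)"
  shows "(abs_step M)\<^sup>*\<^sup>* (q, 0, reg_tape K s) (q + com_size c, 0, reg_tape K (exec c s))"
  using assms
proof (induction c arbitrary: q s)
  case (Inc r)
  let ?T = "reg_tape K s" and ?T' = "reg_tape K (s(r := Suc (s r)))"
  have e: "map_of M (q, a) = Some (if r \<in> set_decode a then (q, a, MoveR)
                 else (q + 1, set_encode (insert r (set_decode a)), MoveL))" if "a < 2 ^ K" for a
    using Inc.prems(3) that by (auto simp: agrees_map_upt)
  have "(abs_step M)\<^sup>*\<^sup>* (q, 0, ?T) (q, int (s r), ?T)"
    using Inc.prems(2)
    by (intro walk_right abs_stepI[where b = "?T (int _)" and D = MoveR])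
      (auto simp: e reg_tape_less set_decode_reg_tape)
  moreover have "abs_step M (q, int (s r), ?T) (q + 1, int (s r) - 1, ?T')"
    using Inc.prems(2)
    by (intro abs_stepI[where D = MoveL, OF _ reg_tape_inc[symmetric]])
      (auto simp: e reg_tape_less set_decode_reg_tape)
  moreover have "(abs_step M)\<^sup>*\<^sup>* (q + 1, int (s r) - 1, ?T') (q + 2, 0, ?T')"
    using Inc.prems(3) by (intro walk_left[of _ K]) (auto simp: reg_tape_less)
  ultimately show ?case
    by (metis (no_types, lifting) com_size.simps(2) exec.simps(2) rtranclp.rtrancl_into_rtrancl rtranclp_trans)
next
  case (Seq c1 c2)
  have "(abs_step M)\<^sup>*\<^sup>* (q, 0, reg_tape K s) (q + com_size c1, 0, reg_tape K (exec c1 s))"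
    using Seq by auto
  moreover have "(abs_step M)\<^sup>*\<^sup>* (q + com_size c1, 0, reg_tape K (exec c1 s))
      (q + com_size c1 + com_size c2, 0, reg_tape K (exec c2 (exec c1 s)))"
    using Seq by (intro Seq.IH(2)) auto
  ultimately show ?case by (simp add: add.assoc)
next
  case (Loop r c)
  have r: "r < K" "r \<notin> vars c" using Loop.prems by auto
  have e0: "map_of M (q, a) = Some (if r \<in> set_decode a then (q, a, MoveR) else (q + 1, a, MoveL))"
    if "a < 2 ^ K" for a
    using Loop.prems(3) that by (simp add: agrees_map_upt)
  have e1: "map_of M (q + 1, 2 ^ K) = Some (q + com_size c + 4, 2 ^ K, MoveR)"
    using Loop.prems(3) by simp
  have e2: "map_of M (q + 1, a) = Some (q + 2, set_encode (set_decode a - {r}), MoveL)" if "a < 2 ^ K" for a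
    using Loop.prems(3) that by (simp add: agrees_map_upt)
  \<comment> \<open>The final position \<open>s r - 1\<close> is the marker cell exactly when the
    register is zero, which makes this scan a zero test.\<close>
  have test: "(abs_step M)\<^sup>*\<^sup>* (q, 0, reg_tape K s) (q + 1, int (s r) - 1, reg_tape K s)" for s
  proof -
    have "(abs_step M)\<^sup>*\<^sup>* (q, 0, reg_tape K s) (q, int (s r), reg_tape K s)"
      using r
      by (intro walk_right abs_stepI[where b = "reg_tape K s (int _)" and D = MoveR])
        (auto simp: e0 reg_tape_less set_decode_reg_tape)
    moreover have "abs_step M (q, int (s r), reg_tape K s) (q + 1, int (s r) - 1, reg_tape K s)"
      by (intro abs_stepI[where b = "reg_tape K s (int (s r))" and D = MoveL])
        (auto simp: e0 reg_tape_less set_decode_reg_tape)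
    ultimately show ?thesis by (rule rtranclp.rtrancl_into_rtrancl)
  qed
  have "s r = k \<Longrightarrow> (abs_step M)\<^sup>*\<^sup>* (q, 0, reg_tape K s)
          (q + com_size c + 4, 0, reg_tape K (exec (Loop r c) s))" for k s
  proof (induction k arbitrary: s)
    case 0
    have "abs_step M (q + 1, int (s r) - 1, reg_tape K s) (q + com_size c + 4, 0, reg_tape K s)"
      using 0 e1 by (intro abs_stepI[where b = "2 ^ K" and D = MoveR]) auto
    moreover have "exec (Loop r c) s = s" using 0 by (auto simp: fun_upd_idem)
    ultimately show ?case using test[of s] by (metis rtranclp.rtrancl_into_rtrancl)
  next
    case (Suc k)
    let ?s = "s(r := k)"
    have "abs_step M (q + 1, int k, reg_tape K s) (q + 2, int k - 1, reg_tape K ?s)"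
      by (intro abs_stepI[where D = MoveL, OF _ reg_tape_dec[where s = s and r = r and k = k, OF Suc.prems, symmetric]])
        (auto simp: e2[simplified] reg_tape_less)
    then have 1: "(abs_step M)\<^sup>*\<^sup>* (q, 0, reg_tape K s) (q + 2, int k - 1, reg_tape K ?s)"
      using test[of s] Suc.prems by simp
    have 2: "(abs_step M)\<^sup>*\<^sup>* (q + 2, int k - 1, reg_tape K ?s) (q + 3, 0, reg_tape K ?s)"
      using Loop.prems(3) by (intro walk_left[of _ K]) (auto simp: reg_tape_less)
    have 3: "(abs_step M)\<^sup>*\<^sup>* (q + 3, 0, reg_tape K ?s) (q + 3 + com_size c, 0, reg_tape K (exec c ?s))"
      using Loop.prems by (intro Loop.IH) auto
    have 4: "(abs_step M)\<^sup>*\<^sup>* (q + 3 + com_size c, 0, reg_tape K (exec c ?s)) (q, 0, reg_tape K (exec c ?s))"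
      using Loop.prems(3) by (intro walk_left[of _ K]) (auto simp: reg_tape_less add_ac)
    have 5: "(abs_step M)\<^sup>*\<^sup>* (q, 0, reg_tape K (exec c ?s))
        (q + com_size c + 4, 0, reg_tape K (exec (Loop r c) (exec c ?s)))"
      using r by (intro Suc.IH) (simp add: exec_fresh)
    show ?case
      unfolding exec_Loop_Suc[of r c s k, OF r(2) Suc.prems]
      by (rule rtranclp_trans[OF 1 rtranclp_trans[OF 2 rtranclp_trans[OF 3 rtranclp_trans[OF 4 5]]]])
  qed
  then show ?case by (simp add: add.assoc)
qed auto

section \<open>Distinctness of the keys of compiled tables\<close>

definition table_on :: "nat set \<Rightarrow> tm \<Rightarrow> bool" where
  "table_on Q M \<longleftrightarrow> distinct (map fst M) \<and> fst ` fst ` set M \<subseteq> Q"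

text \<open>Blocks occupy disjoint sets of states, so their keys never clash; through
  \<open>agrees_distinct\<close> each block then behaves inside the whole machine as it does
  alone.\<close>

lemma table_on_append:
  assumes "table_on Q M" "table_on Q' M'" "Q \<inter> Q' = {}" "Q \<union> Q' \<subseteq> R"
  shows "table_on R (M @ M')"
  using assms unfolding table_on_def map_append distinct_append set_append set_map image_Un by blast

lemma table_on_Nil: "table_on Q []"
  by (simp add: table_on_def)

lemma table_on_row: "table_on {q} (map (\<lambda>a. ((q, a), f a)) [0..<n])"
  by (auto simp: table_on_def distinct_map inj_on_def)

lemma table_on_marked_row: "table_on {q} (((q, n), v) # map (\<lambda>a. ((q, a), f a)) [0..<n])"
  by (auto simp: table_on_def distinct_map inj_on_def)

lemma table_on_compile: "table_on {q..<q + com_size c} (compile K c q)"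
proof (induction c arbitrary: q)
  case (Inc r)
  show ?case
    unfolding compile.simps walk_def by (rule table_on_append[OF table_on_row table_on_marked_row]) auto
next
  case (Seq c1 c2)
  show ?case
    unfolding compile.simps by (rule table_on_append[OF Seq.IH]) auto
next
  case (Loop r c)
  have 1: "table_on {q + 3..<q + com_size c + 4}
      (compile K c (q + 3) @ walk K (q + com_size c + 3) q)"
    unfolding walk_def by (rule table_on_append[OF Loop.IH table_on_marked_row]) auto
  have 2: "table_on {q + 2..<q + com_size c + 4}
      (walk K (q + 2) (q + 3) @ compile K c (q + 3) @ walk K (q + com_size c + 3) q)"
    unfolding walk_def[of K "q + 2"] by (rule table_on_append[OF table_on_marked_row 1]) auto
  have 3: "table_on {q + 1..<q + com_size c + 4}
      ((((q + 1, 2 ^ K), (q + com_size c + 4, 2 ^ K, MoveR)) #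
     map (\<lambda>a. ((q + 1, a), (q + 2, set_encode (set_decode a - {r}), MoveL))) [0..<2 ^ K]) @
     walk K (q + 2) (q + 3) @ compile K c (q + 3) @ walk K (q + com_size c + 3) q)"
    by (rule table_on_append[OF table_on_marked_row 2]) auto
  show ?case
    unfolding compile.simps by (rule table_on_append[OF table_on_row 3[unfolded append_Cons]]) auto
qed (simp add: table_on_Nil)

text \<open>
  The input tape is already the tape for register \<open>0\<close> up to the marker. The states
  \<open>com_size c + 5 + j\<close> with \<open>j \<le> x\<close> write \<open>x\<close> into register \<open>1\<close>, so that \<open>x\<close> enters the table
  only through its length and one start entry. The states \<open>com_size c + 2\<close> and
  \<open>com_size c + 3\<close> clean up all tracks except that of register \<open>0\<close>.
\<close>

definition machine :: "nat \<Rightarrow> com \<Rightarrow> nat \<Rightarrow> tm" where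
  "machine K c x =
     [((0, 0), (1, 0, MoveL)), ((0, 1), (1, 1, MoveL)), ((1, 0), (com_size c + 5 + x, 2 ^ K, MoveR))] @
     map (\<lambda>j. ((com_size c + 5 + Suc j, 0), (com_size c + 5 + j, 2, MoveR))) [0..<x] @
     map (\<lambda>j. ((com_size c + 5 + Suc j, 1), (com_size c + 5 + j, 3, MoveR))) [0..<x] @
     walk K (com_size c + 5) 2 @
     compile K c 2 @
     map (\<lambda>a. ((com_size c + 2, a), if 0 \<in> set_decode a then (com_size c + 2, 1, MoveR)
                else (com_size c + 3, 0, MoveL))) [0..<2 ^ K] @
     walk K (com_size c + 3) (com_size c + 4)"

lemma table_on_machine: "table_on (- {com_size c + 4}) (machine K c x)"
proof -
  let ?E = "com_size c"
  have 1: "table_on {?E + 2..?E + 3} (map (\<lambda>a. ((?E + 2, a), if 0 \<in> set_decode a then (?E + 2, 1, MoveR)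
                else (?E + 3, 0, MoveL))) [0..<2 ^ K] @ walk K (?E + 3) (?E + 4))" (is "table_on _ ?M1")
    unfolding walk_def by (rule table_on_append[OF table_on_row table_on_marked_row]) auto
  have 2: "table_on {2..?E + 3} (compile K c 2 @ ?M1)"
    by (rule table_on_append[OF table_on_compile 1]) auto
  have 3: "table_on ({2..?E + 3} \<union> {?E + 5}) (walk K (?E + 5) 2 @ compile K c 2 @ ?M1)"
    unfolding walk_def[of K "?E + 5"] by (rule table_on_append[OF table_on_marked_row 2]) auto
  have 4: "table_on ({0, 1} \<union> {?E + 6..})
     ([((0, 0), (1, 0, MoveL)), ((0, 1), (1, 1, MoveL)), ((1, 0), (?E + 5 + x, 2 ^ K, MoveR))] @
     map (\<lambda>j. ((?E + 5 + Suc j, 0), (?E + 5 + j, 2, MoveR))) [0..<x] @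
     map (\<lambda>j. ((?E + 5 + Suc j, 1), (?E + 5 + j, 3, MoveR))) [0..<x])"
    by (auto simp: table_on_def distinct_map inj_on_def)
  show ?thesis
    using table_on_append[OF 4 3, of "- {?E + 4}"] by (auto simp: machine_def)
qed

lemma machine_halts: "map_of (machine K c x) (com_size c + 4, a) = None"
  using table_on_machine[of c K x] by (force simp: table_on_def map_of_eq_None_iff)

lemma length_takeWhile_ones:
  "(\<And>i. i < m \<Longrightarrow> nth_default 0 rs i = 1) \<Longrightarrow> nth_default 0 rs m = 0 \<Longrightarrow>
   length (takeWhile (\<lambda>a. a = 1) rs) = (m::nat)" for rs :: "nat list"
proof (induction m arbitrary: rs)
  case 0
  then show ?case by (cases rs) auto
next
  case (Suc m)
  from Suc.prems(1)[of 0] obtain rs' where rs: "rs = 1 # rs'" by (cases rs) auto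
  have "length (takeWhile (\<lambda>a. a = 1) rs') = m"
    using Suc.prems(1)[of "Suc _"] Suc.prems(2) by (intro Suc.IH) (auto simp: rs)
  then show ?case by (simp add: rs)
qed

lemma machine_outputs:
  assumes "wf_com c" "vars c \<subseteq> {..<K}" "2 \<le> K"
  shows "tm_outputs (machine K c x) n (exec c (\<lambda>i. if i = 0 then n else if i = 1 then x else 0) 0)"
proof -
  define s where "s = (\<lambda>i::nat. if i = 0 then n else if i = 1 then x else 0)"
  define M where "M = machine K c x"
  define E where "E = com_size c"
  have K: "(4::nat) \<le> 2 ^ K" using power_increasing[OF assms(3), of "2::nat"] by simp
  have "agrees M (machine K c x)" unfolding M_def 
    using table_on_machine by (intro agrees_distinct) (auto simp: table_on_def)
  then have ag: "map_of M (0, 0) = Some (1, 0, MoveL)" "map_of M (0, 1) = Some (1, 1, MoveL)"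
    "map_of M (1, 0) = Some (E + 5 + x, 2 ^ K, MoveR)"
    "\<And>j. j < x \<Longrightarrow> map_of M (E + 5 + Suc j, 0) = Some (E + 5 + j, 2, MoveR)"
    "\<And>j. j < x \<Longrightarrow> map_of M (E + 5 + Suc j, 1) = Some (E + 5 + j, 3, MoveR)"
    "agrees M (walk K (E + 5) 2)" "agrees M (compile K c 2)"
    "\<And>a. a < 2 ^ K \<Longrightarrow> map_of M (E + 2, a) = Some (if 0 \<in> set_decode a then (E + 2, 1, MoveR)
                else (E + 3, 0, MoveL))"
    "agrees M (walk K (E + 3) (E + 4))"
    unfolding machine_def[of K c x] E_def agrees_simps agrees_map_upt by blast+
  define T0 :: "int \<Rightarrow> nat" where "T0 p = (if 0 \<le> p \<and> p < int n then 1 else 0)" for p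
  \<comment> \<open>The tape once \<open>j\<close> of the \<open>x\<close> cells for register
    \<open>1\<close> are marked. Adding \<open>2\<close> sets bit \<open>1\<close> of a cell holding
    \<open>0\<close> or \<open>1\<close>.\<close>
  define T1 where "T1 j = (\<lambda>p. (if p = - 1 then 2 ^ K else T0 p) + (if 0 \<le> p \<and> p < int j then 2 else 0))"
    for j
  have chain: "j \<le> x \<Longrightarrow> (abs_step M)\<^sup>*\<^sup>* (0, 0, T0) (E + 5 + (x - j), int j, T1 j)" for j
  proof (induction j)
    case 0
    have "abs_step M (0, 0, T0) (1, - 1, T0)"
      using ag(1,2) by (intro abs_stepI[where b = "T0 0" and D = MoveL]) (auto simp: T0_def)
    moreover have "abs_step M (1, - 1, T0) (E + 5 + x, 0, T1 0)"
      using ag(3) by (intro abs_stepI[where b = "2 ^ K" and D = MoveR]) (auto simp: T0_def T1_def)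
    ultimately show ?case by simp
  next
    case (Suc j)
    have e: "x - j = Suc (x - Suc j)" using Suc.prems by simp
    have "T1 j (int j) = 0 \<or> T1 j (int j) = 1" by (auto simp: T1_def T0_def)
    then have "abs_step M (E + 5 + (x - j), int j, T1 j) (E + 5 + (x - Suc j), int (Suc j), T1 (Suc j))"
      using ag(4,5)[of "x - Suc j"] Suc.prems unfolding e
      by (intro abs_stepI[where b = "T1 j (int j) + 2" and D = MoveR]) (auto simp: T1_def)
    then show ?case using Suc by auto
  qed
  have bits: "{r. r < K \<and> i < s r} = (if i < n then {0} else {}) \<union> (if i < x then {1} else {})" for i
    using assms(3) by (auto simp: s_def split: if_splits)
  have code: "set_encode {r. r < K \<and> i < s r} = (if i < n then 1 else 0) + (if i < x then 2 else 0)" for i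
    by (simp only: bits) simp
  have T1x: "T1 x = reg_tape K s"
  proof
    fix p show "T1 x p = reg_tape K s p"
      by (cases p rule: int_cases) (auto simp: T1_def T0_def reg_tape_def code)
  qed
  have 1: "(abs_step M)\<^sup>*\<^sup>* (0, 0, T0) (E + 5, int x, reg_tape K s)"
    using chain[of x] T1x by simp
  have 2: "(abs_step M)\<^sup>*\<^sup>* (E + 5, int x, reg_tape K s) (2, 0, reg_tape K s)"
    using ag(6) by (intro walk_left[of _ K]) (auto simp: reg_tape_less)
  have 3: "(abs_step M)\<^sup>*\<^sup>* (2, 0, reg_tape K s) (2 + E, 0, reg_tape K (exec c s))"
    unfolding E_def by (rule compile_correct[OF assms(1,2) ag(7)])
  have main: "(abs_step M)\<^sup>*\<^sup>* (0, 0, T0) (E + 2, 0, reg_tape K (exec c s))"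
    using rtranclp_trans[OF 1 rtranclp_trans[OF 2 3]]
    by (simp add: add.commute)
  define t m where "t = exec c s" and "m = exec c s 0"
  define T2 where "T2 j = (\<lambda>p. if 0 \<le> p \<and> p < int j then 1 else reg_tape K t p)" for j
  have clean: "j \<le> m \<Longrightarrow> (abs_step M)\<^sup>*\<^sup>* (E + 2, 0, reg_tape K t) (E + 2, int j, T2 j)" for j
  proof (induction j)
    case 0
    have "T2 0 = reg_tape K t" by (auto simp: T2_def)
    then show ?case by simp
  next
    case (Suc j)
    have "abs_step M (E + 2, int j, T2 j) (E + 2, int (Suc j), T2 (Suc j))"
      using ag(8)[of "T2 j (int j)"] assms(3) Suc.prems
      by (intro abs_stepI[where b = 1 and D = MoveR])
        (auto simp: T2_def reg_tape_less set_decode_reg_tape m_def t_def simp del: set_decode_0)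
    then show ?case using Suc by auto
  qed
  \<comment> \<open>The blank right after the output block ends the count of ones, whatever other
    tracks hold further to the right.\<close>
  define T3 where "T3 = (T2 m)(int m := 0)"
  have "abs_step M (E + 2, int m, T2 m) (E + 3, int m - 1, T3)"
    using ag(8)[of "T2 m (int m)"] unfolding T3_def
    by (intro abs_stepI[where b = 0 and D = MoveL])
      (auto simp: T2_def reg_tape_less set_decode_reg_tape m_def t_def simp del: set_decode_0)
  then have 4: "(abs_step M)\<^sup>*\<^sup>* (0, 0, T0) (E + 3, int m - 1, T3)"
    using main clean[of m] by (auto simp: t_def)
  have 5: "(abs_step M)\<^sup>*\<^sup>* (E + 3, int m - 1, T3) (E + 4, 0, T3)"
    using ag(9) K by (intro walk_left[of _ K]) (auto simp: reg_tape_less T3_def T2_def)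
  have run: "(abs_step M)\<^sup>*\<^sup>* (0, 0, T0) (E + 4, 0, T3)"
    by (rule rtranclp_trans[OF 4 5])
  have "tape_rep 0 T0 [] (replicate n 1)"
    by (auto simp: tape_rep_def T0_def nth_default_def nat_less_iff)
  from abs_steps_tm_reaches[OF run refl refl this]
  obtain ls rs where r: "tm_reaches M (0, [], replicate n 1) (E + 4, ls, rs)" "tape_rep 0 T3 ls rs"
    by blast
  have "nth_default 0 rs i = T3 (int i)" for i using r(2) by (simp add: tape_rep_def)
  then have "length (takeWhile (\<lambda>a. a = 1) rs) = m"
    by (intro length_takeWhile_ones) (auto simp: T3_def T2_def)
  moreover have "tm_next M (E + 4, ls, rs) = None"
    using machine_halts[of K c x] by (simp add: M_def E_def)
  ultimately show ?thesis
    using r(1) unfolding tm_outputs_def M_def m_def s_def by (metis (no_types, lifting))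
qed

section \<open>Primitive recursive functions on natural numbers\<close>

text \<open>Register contents as a stream with register \<open>0\<close> in front: runs of concrete
  programs become rewriting, and shifting registers becomes prepending a value.\<close>

definition push :: "nat \<Rightarrow> (nat \<Rightarrow> nat) \<Rightarrow> nat \<Rightarrow> nat" (infixr "##" 65) where
  "a ## t = case_nat a t"

lemma push_simps [simp]:
  "(a ## t) 0 = a" "(a ## t) (Suc i) = t i" "(a ## t) (numeral k) = t (pred_numeral k)"
  by (simp_all add: push_def numeral_eq_Suc)

lemma push_upd [simp]:
  "(a ## t)(0 := v) = v ## t" "(a ## t)(Suc i := v) = a ## t(i := v)"
  "(a ## t)(numeral k := v) = a ## t(pred_numeral k := v)"
  by (auto simp: push_def fun_eq_iff numeral_eq_Suc split: nat.splits)

lemma push_zero: "0 ## (\<lambda>_. 0) = (\<lambda>_. 0)" "(\<lambda>_. 0)(0 := v) = v ## (\<lambda>_. 0)"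
  by (auto simp: push_def fun_eq_iff split: nat.splits)

text \<open>Relocation by one register: a subprogram can run while register \<open>0\<close> keeps a
  saved value or a loop counter.\<close>

primrec up :: "com \<Rightarrow> com" where
  "up Skip = Skip"
| "up (Inc r) = Inc (Suc r)"
| "up (Seq c1 c2) = Seq (up c1) (up c2)"
| "up (Loop r c) = Loop (Suc r) (up c)"

lemma vars_up: "vars (up c) = Suc ` vars c"
  by (induction c) auto

lemma wf_up: "wf_com c \<Longrightarrow> wf_com (up c)"
  by (induction c) (auto simp: vars_up)

lemma exec_up: "exec (up c) (a ## t) = a ## exec c t"
proof (induction c arbitrary: t)
  case (Loop r c)
  have "(exec (up c) ^^ n) (a ## t) = a ## (exec c ^^ n) t" for n t
    using Loop by (induction n) auto
  then show ?case by simp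
qed auto

lemma funpow_exec_up: "(exec (up c) ^^ n) (a ## t) = a ## (exec c ^^ n) t"
  by (induction n) (auto simp: exec_up)

lemma funpow_Skip [simp]: "(exec Skip ^^ n) s = s"
  by (induction n) auto

lemma funpow_Inc [simp]: "(exec (Inc r) ^^ n) s = s(r := s r + n)"
  by (induction n) auto

lemma funpow_Inc_Inc [simp]:
  "r \<noteq> r' \<Longrightarrow> (exec (Seq (Inc r) (Inc r')) ^^ n) s = s(r := s r + n, r' := s r' + n)"
  by (induction n) (auto simp: fun_eq_iff)

section \<open>Programs for copying, swapping, pairing and unpairing\<close>

definition copy_com :: com where
  "copy_com = Seq (Loop 0 (Seq (Inc 1) (Inc 2))) (Loop 2 (Inc 0))"

definition swap_com :: com where
  "swap_com = Seq (Loop 0 (Inc 2)) (Seq (Loop 1 (Inc 0)) (Loop 2 (Inc 1)))"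

lemma exec_copy: "exec copy_com (x ## 0 ## 0 ## t) = x ## x ## 0 ## t"
  by (simp add: copy_com_def)

lemma exec_swap: "exec swap_com (a ## b ## 0 ## t) = b ## a ## 0 ## t"
  by (simp add: swap_com_def)

definition add_count_com :: com where
  "add_count_com = Seq (Inc 3) (Seq (Loop 3 (Seq (Inc 2) (Inc 4))) (Loop 4 (Inc 3)))"

text \<open>Computes \<open>triangle (a + b) + a\<close>. Register \<open>2\<close> starts at
  \<open>a\<close>; in each of the \<open>a + b\<close> rounds register \<open>3\<close> is
  incremented and then added to it.\<close>

definition pair_com :: com where
  "pair_com = Seq (Loop 0 (Seq (Inc 1) (Inc 2)))
     (Seq (Loop 1 add_count_com) (Seq (Loop 3 Skip) (Loop 2 (Inc 0))))"

lemma exec_add_count: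
  "exec add_count_com (a ## b ## c ## k ## 0 ## t) = a ## b ## (c + Suc k) ## Suc k ## 0 ## t"
  by (simp add: add_count_com_def)

lemma funpow_add_count:
  "(exec add_count_com ^^ n) (a ## b ## c ## 0 ## 0 ## t) = a ## b ## (c + triangle n) ## n ## 0 ## t"
  by (induction n) (simp_all add: exec_add_count add.assoc)

lemma exec_pair:
  "exec pair_com (a ## b ## 0 ## 0 ## 0 ## t) = prod_encode (a, b) ## 0 ## 0 ## 0 ## 0 ## t"
  by (simp add: pair_com_def funpow_add_count prod_encode_def add.commute)

text \<open>
  \<open>next_pair_com\<close> advances the registers \<open>1\<close> and \<open>2\<close> along the diagonals in the order of
  \<open>prod_decode\<close>; register \<open>4\<close> is a flag that is lowered in the first round of the loop on
  register \<open>3\<close>.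
\<close>

definition first_round_com :: com where
  "first_round_com = Seq (Inc 5) (Seq (Loop 4 (Seq (Loop 5 Skip) (Inc 1))) (Loop 5 (Inc 2)))"

definition next_pair_com :: com where
  "next_pair_com = Seq (Loop 2 (Inc 3)) (Seq (Inc 4) (Seq (Loop 3 first_round_com)
     (Loop 4 (Seq (Loop 1 (Inc 2)) (Inc 2)))))"

definition unpair_com :: com where
  "unpair_com = Seq (Loop 0 next_pair_com) (Seq (Loop 1 (Inc 0)) (Loop 2 (Inc 1)))"

lemma exec_first_round:
  "exec first_round_com (x ## a ## b ## c ## 1 ## 0 ## t) = x ## Suc a ## b ## c ## 0 ## 0 ## t"
  "exec first_round_com (x ## a ## b ## c ## 0 ## 0 ## t) = x ## a ## Suc b ## c ## 0 ## 0 ## t"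
  by (simp_all add: first_round_com_def)

lemma funpow_first_round:
  "(exec first_round_com ^^ Suc n) (x ## a ## 0 ## c ## 1 ## 0 ## t)
    = x ## Suc a ## n ## c ## 0 ## 0 ## t"
proof (induction n)
  case 0
  then show ?case using exec_first_round(1) by simp
next
  case (Suc n)
  then show ?case by (simp only: funpow.simps o_apply exec_first_round(2))
qed

lemma exec_next_pair:
  "exec next_pair_com (x ## a ## b ## 0 ## 0 ## 0 ## t) =
     (if b = 0 then x ## 0 ## Suc a ## 0 ## 0 ## 0 ## t else x ## Suc a ## (b - 1) ## 0 ## 0 ## 0 ## t)"
proof (cases b)
  case (Suc n)
  then show ?thesis
    using funpow_first_round[of n x a 0 t] by (simp add: next_pair_com_def del: funpow.simps)
qed (simp add: next_pair_com_def)

lemma prod_decode_Suc: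
  "prod_decode (Suc k) = (case prod_decode k of (a, b) \<Rightarrow> if b = 0 then (0, Suc a) else (Suc a, b - 1))"
proof -
  obtain a b where ab: "prod_decode k = (a, b)" by fastforce
  then have k: "k = prod_encode (a, b)" by (metis prod_decode_inverse)
  have "Suc k = prod_encode (if b = 0 then (0, Suc a) else (Suc a, b - 1))"
    unfolding k by (cases b) (auto simp: prod_encode_def)
  then show ?thesis using ab by simp
qed

lemma funpow_next_pair:
  "(exec next_pair_com ^^ n) (x ## 0 ## 0 ## 0 ## 0 ## 0 ## t) =
     x ## fst (prod_decode n) ## snd (prod_decode n) ## 0 ## 0 ## 0 ## t"
proof (induction n)
  case 0
  have "prod_decode 0 = (0, 0)" by (simp add: prod_decode_def prod_decode_aux.simps)
  then show ?case by simp
next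
  case (Suc n)
  then show ?case by (simp add: exec_next_pair prod_decode_Suc case_prod_beta)
qed

lemma exec_unpair:
  "exec unpair_com (n ## 0 ## 0 ## 0 ## 0 ## 0 ## t) =
     fst (prod_decode n) ## snd (prod_decode n) ## 0 ## 0 ## 0 ## 0 ## t"
  by (simp add: unpair_com_def funpow_next_pair)

lemmas com_defs = copy_com_def swap_com_def add_count_com_def pair_com_def first_round_com_def
  next_pair_com_def unpair_com_def

lemma wf_coms: "wf_com copy_com" "wf_com swap_com" "wf_com pair_com" "wf_com unpair_com"
  by (simp_all add: com_defs)

text \<open>All registers but the first are required to be zero again at the end, so that programs
  compose without cleaning up.\<close>

definition computes :: "com \<Rightarrow> (nat \<Rightarrow> nat) \<Rightarrow> bool" where
  "computes c g \<longleftrightarrow> wf_com c \<and> (\<forall>x. exec c (x ## (\<lambda>_. 0)) = g x ## (\<lambda>_. 0))"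

definition pr_nat :: "(nat \<Rightarrow> nat) \<Rightarrow> bool" where
  "pr_nat g \<longleftrightarrow> (\<exists>c. computes c g)"

lemma pr_natI: "wf_com c \<Longrightarrow> (\<And>x. exec c (x ## (\<lambda>_. 0)) = g x ## (\<lambda>_. 0)) \<Longrightarrow> pr_nat g"
  by (auto simp: pr_nat_def computes_def)

lemma pr_nat_id: "pr_nat (\<lambda>x. x)"
  by (rule pr_natI[of Skip]) auto

lemma pr_nat_Suc: "pr_nat Suc"
  by (rule pr_natI[of "Inc 0"]) auto

lemma pr_nat_zero: "pr_nat (\<lambda>x. 0)"
  by (rule pr_natI[of "Loop 0 Skip"]) auto

lemma pr_nat_comp: "pr_nat f \<Longrightarrow> pr_nat g \<Longrightarrow> pr_nat (\<lambda>x. f (g x))"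
  unfolding pr_nat_def computes_def
  by (elim exE conjE, rule_tac x = "Seq ca c" in exI) auto

lemma pr_nat_const: "pr_nat (\<lambda>x. k)"
  by (induction k) (auto intro: pr_nat_zero pr_nat_comp[OF pr_nat_Suc])

lemma exec_copy_zeros: "exec copy_com (x ## (\<lambda>_. 0)) = x ## x ## (\<lambda>_. 0)"
  using exec_copy[of x "\<lambda>_. 0"] by (simp add: push_zero)

lemma exec_swap_zeros: "exec swap_com (a ## b ## (\<lambda>_. 0)) = b ## a ## (\<lambda>_. 0)"
  using exec_swap[of a b "\<lambda>_. 0"] by (simp add: push_zero)

lemma exec_pair_zeros: "exec pair_com (a ## b ## (\<lambda>_. 0)) = prod_encode (a, b) ## (\<lambda>_. 0)"
  using exec_pair[of a b "\<lambda>_. 0"] by (simp add: push_zero)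

lemma exec_unpair_zeros:
  "exec unpair_com (n ## (\<lambda>_. 0)) = fst (prod_decode n) ## snd (prod_decode n) ## (\<lambda>_. 0)"
  using exec_unpair[of n "\<lambda>_. 0"] by (simp add: push_zero)

lemmas exec_zeros = exec_copy_zeros exec_swap_zeros exec_pair_zeros exec_unpair_zeros

lemma pr_nat_fst: "pr_nat (\<lambda>n. fst (prod_decode n))"
  by (rule pr_natI[of "Seq unpair_com (Loop 1 Skip)"]) (auto simp: exec_zeros wf_coms push_zero)

lemma pr_nat_snd: "pr_nat (\<lambda>n. snd (prod_decode n))"
  by (rule pr_natI[of "Seq unpair_com (Seq (Loop 0 Skip) (Loop 1 (Inc 0)))"])
    (auto simp: exec_zeros wf_coms push_zero)

lemma pr_nat_pair:
  assumes "pr_nat f" "pr_nat g"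
  shows "pr_nat (\<lambda>x. prod_encode (f x, g x))"
proof -
  obtain cf cg where "computes cf f" "computes cg g" using assms by (auto simp: pr_nat_def)
  then show ?thesis
    by (intro pr_natI[of "Seq copy_com (Seq (up cf) (Seq swap_com (Seq (up cg) pair_com)))"])
      (auto simp: computes_def wf_coms wf_up exec_zeros exec_up)
qed

lemma pr_nat_iterate:
  assumes "pr_nat g"
  shows "pr_nat (\<lambda>x. (g ^^ fst (prod_decode x)) (snd (prod_decode x)))"
proof -
  obtain c where c: "computes c g" using assms by (auto simp: pr_nat_def)
  have "(exec c ^^ n) (a ## (\<lambda>_. 0)) = (g ^^ n) a ## (\<lambda>_. 0)" for n a
    using c by (induction n) (auto simp: computes_def)
  then show ?thesis
    using c by (intro pr_natI[of "Seq unpair_com (Seq (Loop 0 (up c)) (Loop 1 (Inc 0)))"])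
      (auto simp: computes_def wf_coms wf_up exec_zeros funpow_exec_up vars_up push_zero)
qed

text \<open>
  The second argument is built into the machine, in a way that is uniform enough for the
  table to be a primitive recursive function of it.
\<close>

lemma pr_nat_machine:
  assumes "pr_nat g"
  shows "\<exists>K c. \<forall>n x. tm_outputs (machine K c x) n (g (prod_encode (n, x)))"
proof -
  obtain c where c: "computes c g" using assms by (auto simp: pr_nat_def)
  define c' where "c' = Seq pair_com c"
  define K where "K = Suc (Suc (Max (insert 0 (vars c'))))"
  have "vars c' \<subseteq> {..<K}" using finite_vars[of c'] by (auto simp: K_def less_Suc_eq_le intro!: le_SucI)
  moreover have "wf_com c'" using c by (simp add: c'_def computes_def wf_coms)
  moreover have "(\<lambda>i. if i = 0 then n else if i = 1 then x else 0) = n ## x ## (\<lambda>_. 0)" for n x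
    by (auto simp: push_def fun_eq_iff split: nat.splits)
  then have "exec c' (\<lambda>i. if i = 0 then n else if i = 1 then x else 0) 0 = g (prod_encode (n, x))" for n x
    using c by (simp add: c'_def computes_def exec_zeros)
  ultimately have "tm_outputs (machine K c' x) n (g (prod_encode (n, x)))" for n x
    using machine_outputs[of c' K x n] by (simp add: K_def)
  then show ?thesis by blast
qed

lemma pr_nat_computable:
  assumes "pr_nat g"
  shows "computable g"
proof -
  have "pr_nat (\<lambda>n. g (fst (prod_decode n)))" by (rule pr_nat_comp[OF assms pr_nat_fst])
  from pr_nat_machine[OF this] show ?thesis by (auto simp: computable_def)
qed

section \<open>Primitive recursive functions on coded data\<close>

text \<open>With codes attached to types, closure rules can be applied by the shape of a term. The
  instances are chosen to match the codings in the statement, see \<open>encode_tm\<close> and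
  \<open>pattern_of_eq\<close>.\<close>

class encodable =
  fixes encode :: "'a \<Rightarrow> nat"
  assumes inj_encode: "inj encode"

lemma encode_eq_iff [simp]: "encode x = encode y \<longleftrightarrow> x = y"
  using inj_encode by (auto dest: injD)

text \<open>Every number is a code, so quantifiers over such a type are quantifiers over numbers, as
  \<open>Pi02I\<close> requires.\<close>

class bij_encodable = encodable +
  assumes surj_encode: "surj encode"

definition decode :: "nat \<Rightarrow> 'a::bij_encodable" where
  "decode = inv encode"

lemma encode_decode [simp]: "encode (decode n) = n"
  by (simp add: decode_def surj_f_inv_f[OF surj_encode])

lemma decode_encode [simp]: "decode (encode x) = x"
  by (simp add: decode_def inj_encode)

lemma decode_eqI: "encode x = n \<Longrightarrow> decode n = x"
  by auto

instantiation nat :: bij_encodable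
begin
definition encode_nat :: "nat \<Rightarrow> nat" where [simp]: "encode_nat n = n"
instance by standard (auto simp: inj_def)
end

instantiation int :: bij_encodable
begin
definition encode_int :: "int \<Rightarrow> nat" where "encode_int = int_encode"
instance by standard (simp_all add: encode_int_def inj_int_encode surj_int_encode)
end

instantiation bool :: encodable
begin
definition encode_bool :: "bool \<Rightarrow> nat" where "encode_bool b = of_bool b"
instance by standard (auto simp: encode_bool_def inj_def)
end

instantiation direction :: encodable
begin
definition encode_direction :: "direction \<Rightarrow> nat" where "encode_direction = direction_encode"
instance by standard (auto simp: encode_direction_def direction_encode_def inj_def split: direction.splits)
end

instantiation prod :: (encodable, encodable) encodable
begin
definition encode_prod :: "'a \<times> 'b \<Rightarrow> nat" where
  "encode_prod p = prod_encode (encode (fst p), encode (snd p))"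
instance by standard (auto simp: encode_prod_def inj_def)
end

instance prod :: (bij_encodable, bij_encodable) bij_encodable
proof
  have "\<exists>p::'a \<times> 'b. n = encode p" for n
    by (rule exI[of _ "(decode (fst (prod_decode n)), decode (snd (prod_decode n)))"])
      (simp add: encode_prod_def)
  then show "surj (encode :: 'a \<times> 'b \<Rightarrow> nat)" by (auto simp: surj_def)
qed

instantiation list :: (encodable) encodable
begin
definition encode_list :: "'a list \<Rightarrow> nat" where
  "encode_list xs = list_encode (map encode xs)"
instance
proof
  show "inj (encode :: 'a list \<Rightarrow> nat)"
    by (rule injI) (simp add: encode_list_def list_encode_eq inj_map_eq_map[OF inj_encode])
qed
end

instance list :: (bij_encodable) bij_encodable
proof
  have "\<exists>xs::'a list. n = encode xs" for n
    by (rule exI[of _ "map decode (list_decode n)"]) (simp add: encode_list_def comp_def)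
  then show "surj (encode :: 'a list \<Rightarrow> nat)" by (auto simp: surj_def)
qed

instantiation option :: (encodable) encodable
begin
definition encode_option :: "'a option \<Rightarrow> nat" where
  "encode_option x = (case x of None \<Rightarrow> 0 | Some a \<Rightarrow> Suc (encode a))"
instance by standard (auto simp: encode_option_def inj_def split: option.splits)
end

lemma encode_Pair [simp]: "encode (a, b) = prod_encode (encode a, encode b)"
  by (simp add: encode_prod_def)

lemma encode_Nil [simp]: "encode [] = 0"
  by (simp add: encode_list_def)

lemma encode_Cons [simp]: "encode (a # l) = Suc (prod_encode (encode a, encode l))"
  by (simp add: encode_list_def)

section \<open>Closure rules for primitive recursion between coded types\<close>

definition pr :: "('a::encodable \<Rightarrow> 'b::encodable) \<Rightarrow> bool" where
  "pr f \<longleftrightarrow> (\<exists>g. pr_nat g \<and> (\<forall>x. g (encode x) = encode (f x)))"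

named_theorems pr_intros

lemma pr_nat_iff: "pr f \<longleftrightarrow> pr_nat f" for f :: "nat \<Rightarrow> nat"
proof -
  have "g = f" if "\<forall>x. g x = f x" for g using that by auto
  then show ?thesis by (auto simp: pr_def)
qed

lemma pr_track: "pr g \<Longrightarrow> (\<And>x. g (encode x) = encode (f x)) \<Longrightarrow> pr f" for g :: "nat \<Rightarrow> nat"
  unfolding pr_nat_iff by (auto simp: pr_def)

lemma pr_tracked:
  assumes "pr f"
  obtains g :: "nat \<Rightarrow> nat" where "pr g" "\<And>x. g (encode x) = encode (f x)"
proof -
  from assms obtain g where "pr_nat g" "\<forall>x. g (encode x) = encode (f x)"
    unfolding pr_def by blast
  then show ?thesis using that by (simp add: pr_nat_iff)
qed

text \<open>Only codes matter, so a change of type that keeps the code, such as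
  \<open>encode\<close> or \<open>decode\<close>, is free.\<close>

lemma pr_retype: "pr f \<Longrightarrow> (\<And>x. encode (f x) = encode (g x)) \<Longrightarrow> pr g"
  by (auto simp: pr_def)

lemma pr_id [pr_intros]: "pr (\<lambda>x. x)"
  using pr_nat_id by (auto simp: pr_def)

lemma pr_const [pr_intros]: "pr (\<lambda>x. c)"
  using pr_nat_const[of "encode c"] by (auto simp: pr_def)

lemma pr_comp:
  assumes "pr f" "pr g"
  shows "pr (\<lambda>x. f (g x))"
proof -
  obtain f' g' where "pr_nat f'" "\<And>x. f' (encode x) = encode (f x)"
    "pr_nat g'" "\<And>x. g' (encode x) = encode (g x)"
    using assms unfolding pr_def by blast
  then show ?thesis
    unfolding pr_def using pr_nat_comp[of f' g'] by (intro exI[of _ "\<lambda>x. f' (g' x)"]) simp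
qed

lemma pr_Pair [pr_intros]:
  assumes "pr f" "pr g"
  shows "pr (\<lambda>x. (f x, g x))"
proof -
  obtain f' g' where "pr_nat f'" "\<And>x. f' (encode x) = encode (f x)"
    "pr_nat g'" "\<And>x. g' (encode x) = encode (g x)"
    using assms unfolding pr_def by blast
  then show ?thesis
    unfolding pr_def using pr_nat_pair[of f' g']
    by (intro exI[of _ "\<lambda>x. prod_encode (f' x, g' x)"]) simp
qed

lemma pr_fst [pr_intros]: "pr f \<Longrightarrow> pr (\<lambda>x. fst (f x))"
  by (rule pr_comp[of fst]) (rule pr_track[of "\<lambda>n. fst (prod_decode n)"],
      auto simp: pr_nat_iff pr_nat_fst encode_prod_def)

lemma pr_snd [pr_intros]: "pr f \<Longrightarrow> pr (\<lambda>x. snd (f x))"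
  by (rule pr_comp[of snd]) (rule pr_track[of "\<lambda>n. snd (prod_decode n)"],
      auto simp: pr_nat_iff pr_nat_snd encode_prod_def)

text \<open>The pattern of all rules with binders: a body becomes a unary function of the context
  paired with the bound values, so \<open>pr\<close> needs no notion of arity.\<close>

lemma pr_case_prod [pr_intros]:
  "pr p \<Longrightarrow> pr (\<lambda>q. g (fst q) (fst (snd q)) (snd (snd q))) \<Longrightarrow> pr (\<lambda>x. case p x of (a, b) \<Rightarrow> g x a b)"
  using pr_comp[of "\<lambda>q. g (fst q) (fst (snd q)) (snd (snd q))" "\<lambda>x. (x, p x)"]
  by (simp add: pr_Pair pr_id case_prod_beta)

lemma pr_Let [pr_intros]:
  "pr e \<Longrightarrow> pr (\<lambda>q. b (fst q) (snd q)) \<Longrightarrow> pr (\<lambda>x. let a = e x in b x a)"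
  using pr_comp[of "\<lambda>q. b (fst q) (snd q)" "\<lambda>x. (x, e x)"] by (simp add: pr_Pair pr_id)

lemma pr_Suc [pr_intros]: "pr f \<Longrightarrow> pr (\<lambda>x. Suc (f x))"
  by (rule pr_comp[of Suc]) (simp_all add: pr_nat_iff pr_nat_Suc)

lemma pr_prod_encode [pr_intros]: "pr f \<Longrightarrow> pr g \<Longrightarrow> pr (\<lambda>x. prod_encode (f x, g x))"
  using pr_retype[of "\<lambda>x. (f x, g x)" "\<lambda>x. prod_encode (f x, g x)"] by (simp add: pr_Pair)

lemma pr_prod_decode [pr_intros]: "pr f \<Longrightarrow> pr (\<lambda>x. prod_decode (f x))"
  by (rule pr_retype[of f]) (auto simp: encode_prod_def)

lemma pr_encode [pr_intros]: "pr f \<Longrightarrow> pr (\<lambda>x. encode (f x))"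
  by (rule pr_retype[of f]) auto

lemma pr_decode [pr_intros]: "pr f \<Longrightarrow> pr (\<lambda>x. decode (f x))"
  by (rule pr_retype[of f]) auto

text \<open>The numerical iterator takes no parameters, so the context \<open>x\<close> is carried
  unchanged inside the iterated state.\<close>

lemma pr_funpow [pr_intros]:
  fixes g :: "'a::encodable \<Rightarrow> 'b::encodable \<Rightarrow> 'b"
  assumes "pr n" "pr (\<lambda>p. g (fst p) (snd p))" "pr f"
  shows "pr (\<lambda>x. ((g x) ^^ n x) (f x))"
proof -
  have "pr (\<lambda>p. (fst p, g (fst p) (snd p)))" by (intro pr_intros assms)
  then obtain h where h: "pr h" "\<And>p. h (encode p) = encode (fst p, g (fst p) (snd p))"
    by (rule pr_tracked) auto
  define H where "H = (\<lambda>x. (h ^^ fst (prod_decode x)) (snd (prod_decode x)))"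
  have H: "pr H" unfolding H_def using h(1) by (simp add: pr_nat_iff pr_nat_iterate)
  have 1: "pr (\<lambda>x. snd (prod_decode (H (encode (n x, x, f x)))))"
    by (intro pr_intros pr_comp[OF H] assms)
  have 2: "(h ^^ k) (prod_encode (encode x, encode a)) = prod_encode (encode x, encode ((g x ^^ k) a))"
    for k x a
    using h(2) by (induction k) (auto simp: encode_prod_def)
  show ?thesis
    by (rule pr_retype[OF 1]) (simp add: H_def 2)
qed

section \<open>Truth values and arithmetic\<close>

lemma pr_if [pr_intros]:
  assumes "pr b" "pr f" "pr g"
  shows "pr (\<lambda>x. if b x then f x else g x)"
proof -
  \<comment> \<open>A conditional is an iteration of length \<open>0\<close> or
    \<open>1\<close>.\<close>
  have "pr (\<lambda>x. ((\<lambda>_. f x) ^^ encode (b x)) (g x))"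
    by (intro pr_intros assms pr_comp[OF assms(2)])
  moreover have "((\<lambda>_. f x) ^^ encode (b x)) (g x) = (if b x then f x else g x)" for x
    by (simp add: encode_bool_def)
  ultimately show ?thesis by simp
qed

lemma pr_not [pr_intros]: "pr p \<Longrightarrow> pr (\<lambda>x. \<not> p x)"
  by (rule pr_retype[OF pr_if[of p "\<lambda>_. False" "\<lambda>_. True"]]) (simp_all add: pr_const)

lemma pr_conj [pr_intros]: "pr p \<Longrightarrow> pr q \<Longrightarrow> pr (\<lambda>x. p x \<and> q x)"
  by (rule pr_retype[OF pr_if[of p q "\<lambda>_. False"]]) (simp_all add: pr_const)

lemma pr_imp [pr_intros]: "pr p \<Longrightarrow> pr q \<Longrightarrow> pr (\<lambda>x. p x \<longrightarrow> q x)"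
  using pr_not[OF pr_conj[of p "\<lambda>x. \<not> q x"]] by (simp add: pr_not)

lemma pr_disj [pr_intros]: "pr p \<Longrightarrow> pr q \<Longrightarrow> pr (\<lambda>x. p x \<or> q x)"
  using pr_imp[of "\<lambda>x. \<not> p x" q] by (simp add: pr_not disj_imp)

lemma pr_pred: "pr f \<Longrightarrow> pr (\<lambda>x. f x - (1::nat))"
proof (rule pr_comp[of "\<lambda>n. n - 1"])
  have "pr (\<lambda>n. fst (((\<lambda>p. (snd p, Suc (snd p))) ^^ n) (0::nat, 0)))"
    by (intro pr_intros)
  moreover have "((\<lambda>p. (snd p, Suc (snd p))) ^^ n) (0::nat, 0) = (n - 1, n)" for n
    by (induction n) auto
  ultimately show "pr (\<lambda>n::nat. n - 1)" by simp
qed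

lemma funpow_pred: "((\<lambda>x. x - Suc 0) ^^ n) m = m - n"
  by (induction n) auto

lemma pr_minus [pr_intros]: "pr f \<Longrightarrow> pr g \<Longrightarrow> pr (\<lambda>x. f x - (g x :: nat))"
  using pr_funpow[of g "\<lambda>x y. y - Suc 0" f] pr_pred[OF pr_snd[OF pr_id]] by (simp add: funpow_pred)

lemma pr_plus [pr_intros]: "pr f \<Longrightarrow> pr g \<Longrightarrow> pr (\<lambda>x. f x + (g x :: nat))"
  using pr_funpow[of g "\<lambda>x. Suc" f] by (simp add: add.commute pr_Suc pr_snd pr_id)

lemma pr_is_zero: "pr f \<Longrightarrow> pr (\<lambda>x. f x = (0::nat))"
proof -
  assume "pr f"
  then have "pr (\<lambda>x. ((\<lambda>_. False) ^^ f x) True)" by (intro pr_intros)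
  moreover have "((\<lambda>_. False) ^^ n) True = (n = 0)" for n by (cases n) auto
  ultimately show ?thesis by simp
qed

lemma pr_le [pr_intros]: "pr f \<Longrightarrow> pr g \<Longrightarrow> pr (\<lambda>x. f x \<le> (g x :: nat))"
  using pr_is_zero[OF pr_minus[of f g]] by simp

lemma pr_eq [pr_intros]: "pr f \<Longrightarrow> pr g \<Longrightarrow> pr (\<lambda>x. f x = g x)"
  using pr_conj[OF pr_le[OF pr_encode[of f] pr_encode[of g]] pr_le[OF pr_encode[of g] pr_encode[of f]]]
  by (simp add: order_eq_iff[symmetric])

lemma pr_even [pr_intros]: "pr f \<Longrightarrow> pr (\<lambda>x. even (f x :: nat))"
proof (rule pr_comp[of even])
  have "pr (\<lambda>n. (Not ^^ n) True)" by (intro pr_intros)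
  moreover have "(Not ^^ n) True = even n" for n by (induction n) auto
  ultimately show "pr (even :: nat \<Rightarrow> bool)" by simp
qed

lemma pr_half [pr_intros]: "pr f \<Longrightarrow> pr (\<lambda>x. f x div (2::nat))"
proof (rule pr_comp[of "\<lambda>n. n div 2"])
  have "pr (\<lambda>n. fst (((\<lambda>p. (snd p, Suc (fst p))) ^^ n) (0::nat, 0::nat)))"
    by (intro pr_intros)
  moreover have "((\<lambda>p. (snd p, Suc (fst p))) ^^ n) (0::nat, 0::nat) = (n div 2, Suc n div 2)" for n
    by (induction n) auto
  ultimately show "pr (\<lambda>n::nat. n div 2)" by simp
qed

lemma pr_set_decode [pr_intros]: "pr f \<Longrightarrow> pr g \<Longrightarrow> pr (\<lambda>x. f x \<in> set_decode (g x))"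
proof -
  assume "pr f" "pr g"
  then have "pr (\<lambda>x. \<not> even (((\<lambda>y. y div 2) ^^ f x) (g x)))" by (intro pr_intros)
  moreover have "((\<lambda>y. y div 2) ^^ n) m = m div 2 ^ n" for n m :: nat
    by (induction n) (simp_all add: mult.commute flip: div_mult2_eq)
  ultimately show ?thesis by (simp add: set_decode_def)
qed

subsection \<open>Lists and options\<close>

lemma pr_Cons [pr_intros]: "pr f \<Longrightarrow> pr g \<Longrightarrow> pr (\<lambda>x. f x # g x)"
  by (rule pr_retype[of "\<lambda>x. Suc (prod_encode (encode (f x), encode (g x)))"]) (auto intro!: pr_intros)

lemma pr_case_list [pr_intros]:
  assumes "pr l" "pr f" "pr (\<lambda>q. g (fst q) (fst (snd q)) (snd (snd q)))"
  shows "pr (\<lambda>x. case l x of [] \<Rightarrow> f x | a # t \<Rightarrow> g x a t)"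
proof -
  obtain h where h: "pr h" "\<And>q. h (encode q) = encode (g (fst q) (fst (snd q)) (snd (snd q)))"
    using assms(3) by (rule pr_tracked) auto
  \<comment> \<open>The code of a nonempty list is the successor of the code of its head and tail,
    so subtracting \<open>1\<close> yields that pair.\<close>
  have 1: "pr (\<lambda>x. if encode (l x) = 0 then encode (f x) else h (prod_encode (encode x, encode (l x) - 1)))"
    by (intro pr_intros assms pr_comp[OF h(1)])
  have 2: "(if encode (l x) = 0 then encode (f x) else h (prod_encode (encode x, encode (l x) - 1)))
      = encode (case l x of [] \<Rightarrow> f x | a # t \<Rightarrow> g x a t)" for x
    using h(2)[of "(x, hd (l x), tl (l x))"] by (cases "l x") auto
  show ?thesis
    by (rule pr_retype[OF 1]) (unfold encode_nat_def, rule 2)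
qed

lemma pr_case_option [pr_intros]:
  assumes "pr l" "pr f" "pr (\<lambda>q. g (fst q) (snd q))"
  shows "pr (\<lambda>x. case l x of None \<Rightarrow> f x | Some a \<Rightarrow> g x a)"
proof -
  obtain h where h: "pr h" "\<And>q. h (encode q) = encode (g (fst q) (snd q))"
    using assms(3) by (rule pr_tracked) auto
  have 1: "pr (\<lambda>x. if encode (l x) = 0 then encode (f x) else h (prod_encode (encode x, encode (l x) - 1)))"
    by (intro pr_intros assms pr_comp[OF h(1)])
  have 2: "(if encode (l x) = 0 then encode (f x) else h (prod_encode (encode x, encode (l x) - 1)))
      = encode (case l x of None \<Rightarrow> f x | Some a \<Rightarrow> g x a)" for x
    using h(2)[of "(x, the (l x))"] by (cases "l x") (auto simp: encode_option_def)
  show ?thesis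
    by (rule pr_retype[OF 1]) (unfold encode_nat_def, rule 2)
qed

lemma pr_Some [pr_intros]: "pr f \<Longrightarrow> pr (\<lambda>x. Some (f x))"
  by (rule pr_retype[of "\<lambda>x. Suc (encode (f x))"]) (auto intro!: pr_intros simp: encode_option_def)

lemma pr_case_direction [pr_intros]:
  "pr D \<Longrightarrow> pr f \<Longrightarrow> pr g \<Longrightarrow> pr (\<lambda>x. case D x of MoveL \<Rightarrow> f x | MoveR \<Rightarrow> g x)"
proof -
  assume "pr D" "pr f" "pr g"
  then have "pr (\<lambda>x. if D x = MoveL then f x else g x)" by (intro pr_intros)
  moreover have "(if D x = MoveL then f x else g x) = (case D x of MoveL \<Rightarrow> f x | MoveR \<Rightarrow> g x)" for x
    by (auto split: direction.split)
  ultimately show ?thesis by simp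
qed

lemma length_le_encode: "length l \<le> encode l"
proof (induction l)
  case (Cons a l)
  then show ?case using le_prod_encode_2[of "encode l" "encode a"] by simp
qed simp

text \<open>Iteration needs its number of rounds in advance. The code of a list bounds its length,
  and surplus rounds on the empty rest change nothing.\<close>

lemma pr_foldl [pr_intros]:
  assumes "pr (\<lambda>q. g (fst q) (fst (snd q)) (snd (snd q)))" "pr f" "pr l"
  shows "pr (\<lambda>x. foldl (g x) (f x) (l x))"
proof -
  define step where "step x p = (case snd p of [] \<Rightarrow> p | a # t \<Rightarrow> (g x (fst p) a, t))" for x p
  have 1: "(step x ^^ n) (a, []) = (a, [])" for x n a
    by (induction n) (auto simp: step_def)
  have st: "step x (a, b # t) = (g x a b, t)" for x a b t by (simp add: step_def)
  have 2: "length t \<le> n \<Longrightarrow> (step x ^^ n) (a, t) = (foldl (g x) a t, [])" for x n a t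
  proof (induction t arbitrary: a n)
    case (Cons b t)
    then obtain m where "n = Suc m" by (cases n) auto
    then show ?case
      using Cons by (simp add: funpow_Suc_right st del: funpow.simps(2))
  qed (simp add: 1)
  have "pr (\<lambda>q. g (fst (fst q)) (fst (snd (fst q))) (fst (snd q)))"
    using pr_comp[OF assms(1), of "\<lambda>q. (fst (fst q), fst (snd (fst q)), fst (snd q))"]
    by (simp add: pr_Pair pr_fst pr_snd pr_id)
  then have "pr (\<lambda>x. fst ((step x ^^ encode (l x)) (f x, l x)))"
    unfolding step_def by (auto intro!: pr_intros assms(2,3))
  then show ?thesis using 2[OF length_le_encode] by simp
qed

lemma pr_rev [pr_intros]: "pr l \<Longrightarrow> pr (\<lambda>x. rev (l x))"
proof -
  assume "pr l"
  then have "pr (\<lambda>x. foldl (\<lambda>acc a. a # acc) [] (l x))" by (intro pr_intros)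
  moreover have "foldl (\<lambda>acc a. a # acc) ys xs = rev xs @ ys" for xs ys :: "'b list"
    by (induction xs arbitrary: ys) auto
  ultimately show ?thesis by simp
qed

lemma pr_append [pr_intros]: "pr l \<Longrightarrow> pr k \<Longrightarrow> pr (\<lambda>x. l x @ k x)"
proof -
  assume "pr l" "pr k"
  then have "pr (\<lambda>x. foldl (\<lambda>acc a. a # acc) (k x) (rev (l x)))" by (intro pr_intros)
  moreover have "foldl (\<lambda>acc a. a # acc) ys xs = rev xs @ ys" for xs ys :: "'b list"
    by (induction xs arbitrary: ys) auto
  ultimately show ?thesis by simp
qed

text \<open>Makes room for the accumulator that \<open>pr_foldl\<close> passes between context and
  list element.\<close>

lemma pr_binder: "pr (\<lambda>q. g (fst q) (snd q)) \<Longrightarrow> pr (\<lambda>q. g (fst q) (snd (snd q)))"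
  using pr_comp[of "\<lambda>q. g (fst q) (snd q)" "\<lambda>q. (fst q, snd (snd q))"] by (simp add: pr_intros)

lemma pr_map [pr_intros]:
  assumes "pr (\<lambda>q. g (fst q) (snd q))" "pr l"
  shows "pr (\<lambda>x. map (g x) (l x))"
proof -
  have "pr (\<lambda>x. rev (foldl (\<lambda>acc a. g x a # acc) [] (l x)))"
    by (intro pr_intros pr_binder[OF assms(1)] assms)
  moreover have "foldl (\<lambda>acc a. h a # acc) ys xs = rev (map h xs) @ ys" for h :: "'b \<Rightarrow> 'c" and xs ys
    by (induction xs arbitrary: ys) auto
  ultimately show ?thesis by simp
qed

lemma pr_ball_set [pr_intros]:
  assumes "pr (\<lambda>q. P (fst q) (snd q))" "pr l"
  shows "pr (\<lambda>x. \<forall>a\<in>set (l x). P x a)"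
proof -
  have "pr (\<lambda>x. foldl (\<lambda>b a. b \<and> P x a) True (l x))"
    by (intro pr_intros pr_binder[OF assms(1)] assms)
  moreover have "foldl (\<lambda>b a. b \<and> Q a) b xs = (b \<and> (\<forall>a\<in>set xs. Q a))" for Q b and xs :: "'b list"
    by (induction xs arbitrary: b) auto
  ultimately show ?thesis by simp
qed

lemma pr_bex_set [pr_intros]:
  "pr (\<lambda>q. P (fst q) (snd q)) \<Longrightarrow> pr l \<Longrightarrow> pr (\<lambda>x. \<exists>a\<in>set (l x). P x a)"
  using pr_not[OF pr_ball_set[of "\<lambda>x a. \<not> P x a" l]] by (simp add: pr_not)

lemma pr_mem [pr_intros]: "pr f \<Longrightarrow> pr l \<Longrightarrow> pr (\<lambda>x. f x \<in> set (l x))"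
proof -
  assume *: "pr f" "pr l"
  have "pr (\<lambda>x. \<exists>a\<in>set (l x). a = f x)"
    by (intro pr_intros * pr_comp[OF *(1)])
  then show ?thesis by simp
qed

lemma pr_upt [pr_intros]: "pr n \<Longrightarrow> pr (\<lambda>x. [0..<n x])"
proof (rule pr_comp[of "\<lambda>n. [0..<n]"])
  have "pr (\<lambda>n. snd (((\<lambda>p. (Suc (fst p), snd p @ [fst p])) ^^ n) (0::nat, [])))"
    by (intro pr_intros)
  moreover have "((\<lambda>p. (Suc (fst p), snd p @ [fst p])) ^^ n) (0::nat, []) = (n, [0..<n])" for n
    by (induction n) auto
  ultimately show "pr (\<lambda>n. [0..<n])" by simp
qed

lemma pr_all_less [pr_intros]:
  assumes "pr (\<lambda>q. P (fst q) (snd q))" "pr n"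
  shows "pr (\<lambda>x. \<forall>i<(n x :: nat). P x i)"
proof -
  have "pr (\<lambda>x. \<forall>i\<in>set [0..<n x]. P x i)" by (intro pr_intros assms)
  then show ?thesis by (simp add: Ball_def)
qed

lemma pr_ex_less [pr_intros]:
  assumes "pr (\<lambda>q. P (fst q) (snd q))" "pr n"
  shows "pr (\<lambda>x. \<exists>i<(n x :: nat). P x i)"
proof -
  have "pr (\<lambda>x. \<exists>i\<in>set [0..<n x]. P x i)" by (intro pr_intros assms)
  then show ?thesis by (simp add: Bex_def)
qed

lemma pr_replicate [pr_intros]: "pr n \<Longrightarrow> pr a \<Longrightarrow> pr (\<lambda>x. replicate (n x) (a x))"
proof -
  assume *: "pr n" "pr a"
  have "pr (\<lambda>x. ((\<lambda>l. a x # l) ^^ n x) [])" by (intro pr_intros * pr_comp[OF *(2)])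
  moreover have "((\<lambda>l. a # l) ^^ n) [] = replicate n a" for a :: 'b and n
    by (induction n) auto
  ultimately show ?thesis by simp
qed

lemma pr_length [pr_intros]: "pr l \<Longrightarrow> pr (\<lambda>x. length (l x))"
proof -
  assume "pr l"
  then have "pr (\<lambda>x. foldl (\<lambda>n a. Suc n) 0 (l x))" by (intro pr_intros)
  moreover have "foldl (\<lambda>n a. Suc n) m xs = m + length xs" for m and xs :: "'b list"
    by (induction xs arbitrary: m) auto
  ultimately show ?thesis by simp
qed

lemma pr_length_takeWhile [pr_intros]:
  assumes "pr (\<lambda>q. P (fst q) (snd q))" "pr l"
  shows "pr (\<lambda>x. length (takeWhile (P x) (l x)))"
proof -
  have "pr (\<lambda>x. fst (foldl (\<lambda>q a. if snd q \<and> P x a then (Suc (fst q), True) else (fst q, False)) (0, True) (l x)))"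
    by (intro pr_intros pr_binder[OF assms(1)] assms)
  moreover have "foldl (\<lambda>q a. if snd q \<and> Q a then (Suc (fst q), True) else (fst q, False)) (n, b) xs
      = (if b then (n + length (takeWhile Q xs), \<forall>a\<in>set xs. Q a) else (n, False))"
    for Q n b and xs :: "'b list"
    by (induction xs arbitrary: n b) auto
  ultimately show ?thesis by simp
qed

lemma pr_map_of [pr_intros]:
  assumes "pr l" "pr k"
  shows "pr (\<lambda>x. map_of (l x) (k x))"
proof -
  have "pr (\<lambda>x. foldl (\<lambda>r e. if fst e = k x then Some (snd e) else r) None (rev (l x)))"
    by (intro pr_intros assms pr_comp[OF assms(2)])
  moreover have "foldl (\<lambda>r e. if fst e = k then Some (snd e) else r) None (rev l) = map_of l k"
    for l :: "('b \<times> 'c) list" and k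
    by (induction l) auto
  ultimately show ?thesis by simp
qed

lemma pr_zip [pr_intros]:
  assumes "pr l" "pr k"
  shows "pr (\<lambda>x. zip (l x) (k x))"
proof -
  define step where "step q a = (case snd q of [] \<Rightarrow> q | b # t \<Rightarrow> ((a, b) # fst q, t))"
    for q :: "('b \<times> 'c) list \<times> 'c list" and a
  have "pr (\<lambda>x. rev (fst (foldl step ([], k x) (l x))))"
    unfolding step_def by (intro pr_intros assms)
  moreover have "rev (fst (foldl step (acc, ys) xs)) = rev acc @ zip xs ys" for acc xs ys
  proof (induction xs arbitrary: acc ys)
    case (Cons a xs)
    then show ?case by (cases ys) (auto simp: step_def)
  qed simp
  ultimately show ?thesis by simp
qed

subsection \<open>Integers\<close>

lemma int_encode_cases:
  "int_encode (int n) = 2 * n" "int_encode (- int (Suc n)) = Suc (2 * n)"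
  by (simp_all add: int_encode_def sum_encode_def)

lemma pr_nat_int [pr_intros]: "pr f \<Longrightarrow> pr (\<lambda>x. nat (f x))"
proof (rule pr_comp[of nat])
  have "pr (\<lambda>n::nat. if even n then n div 2 else 0)" by (intro pr_intros)
  moreover have "(if even (encode i) then encode i div 2 else 0) = encode (nat i)" for i :: int
    by (cases i) (auto simp: encode_int_def int_encode_cases simp del: of_nat_Suc)
  ultimately show "pr nat" by (rule pr_track)
qed

lemma pr_nat_minus_int: "pr f \<Longrightarrow> pr (\<lambda>x. nat (- f x))"
proof (rule pr_comp[of "\<lambda>i. nat (- i)"])
  have "pr (\<lambda>n::nat. if even n then 0 else Suc (n div 2))" by (intro pr_intros)
  moreover have "(if even (encode i) then 0 else Suc (encode i div 2)) = encode (nat (- i))" for i :: int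
    by (cases i) (auto simp: encode_int_def int_encode_cases simp del: of_nat_Suc)
  ultimately show "pr (\<lambda>i. nat (- i))" by (rule pr_track)
qed

lemma pr_int_diff: "pr f \<Longrightarrow> pr g \<Longrightarrow> pr (\<lambda>x. int (f x) - int (g x))"
proof -
  assume *: "pr f" "pr g"
  define h where "h a b = (if b \<le> a then a - b + (a - b) else Suc ((b - a - 1) + (b - a - 1)))" for a b :: nat
  have "encode (int a - int b) = h a b" for a b
  proof (cases "b \<le> a")
    case True
    then obtain c where "a = b + c" using le_Suc_ex by blast
    then show ?thesis by (simp add: h_def encode_int_def int_encode_cases)
  next
    case False
    then obtain c where "b = Suc (a + c)" using less_imp_Suc_add not_le by blast
    then have "int a - int b = - int (Suc c)" "h a b = Suc (2 * c)" by (simp_all add: h_def)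
    then show ?thesis by (simp only: encode_int_def int_encode_cases)
  qed
  moreover have "pr (\<lambda>x. h (f x) (g x))" unfolding h_def by (intro pr_intros *)
  ultimately show ?thesis using pr_retype[of "\<lambda>x. h (f x) (g x)" "\<lambda>x. int (f x) - int (g x)"] by simp
qed

lemma pr_plus_int [pr_intros]: "pr f \<Longrightarrow> pr g \<Longrightarrow> pr (\<lambda>x. f x + g x :: int)"
proof -
  assume *: "pr f" "pr g"
  have "f x + g x = int (nat (f x) + nat (g x)) - int (nat (- f x) + nat (- g x))" for x by simp
  moreover have "pr (\<lambda>x. int (nat (f x) + nat (g x)) - int (nat (- f x) + nat (- g x)))"
    by (intro pr_int_diff pr_intros pr_nat_minus_int *)
  ultimately show ?thesis by simp
qed

section \<open>Bounded simulation of Turing machines\<close>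

lemma encode_tm: "encode M = tm_encode M"
proof -
  have "encode e = (\<lambda>((q, a), (q', b, D)).
      prod_encode (prod_encode (q, a), prod_encode (q', prod_encode (b, direction_encode D)))) e"
    for e :: "(nat \<times> nat) \<times> (nat \<times> nat \<times> direction)"
    by (auto simp: encode_prod_def encode_direction_def split: prod.split)
  then show ?thesis unfolding tm_encode_def encode_list_def by (intro arg_cong[of _ _ list_encode] map_cong) auto
qed

lemma pr_scanned [pr_intros]: "pr l \<Longrightarrow> pr (\<lambda>x. scanned (l x))"
proof -
  assume "pr l"
  then have "pr (\<lambda>x. case l x of [] \<Rightarrow> 0 | a # t \<Rightarrow> a)" by (intro pr_intros)
  moreover have "scanned l = (case l of [] \<Rightarrow> 0 | a # t \<Rightarrow> a)" for l by (cases l) auto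
  ultimately show ?thesis by simp
qed

lemma pr_tl [pr_intros]: "pr l \<Longrightarrow> pr (\<lambda>x. tl (l x))"
proof -
  assume "pr l"
  then have "pr (\<lambda>x. case l x of [] \<Rightarrow> [] | a # t \<Rightarrow> t)" by (intro pr_intros)
  then show ?thesis by (simp add: tl_def)
qed

lemma pr_tm_move [pr_intros]:
  assumes "pr D" "pr ls" "pr rs"
  shows "pr (\<lambda>x. tm_move (D x) (ls x) (rs x))"
proof -
  have e: "tm_move D ls rs = (case D of
      MoveL \<Rightarrow> (case ls of [] \<Rightarrow> ([], 0 # rs) | a # ls' \<Rightarrow> (ls', a # rs))
    | MoveR \<Rightarrow> (case rs of [] \<Rightarrow> (0 # ls, []) | a # rs' \<Rightarrow> (a # ls, rs')))" for D ls rs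
    by (cases D; cases ls; cases rs) auto
  show ?thesis
    unfolding e by (intro pr_intros assms pr_comp[OF assms(2)] pr_comp[OF assms(3)])
qed

lemma pr_tm_next [pr_intros]:
  assumes "pr M" "pr c"
  shows "pr (\<lambda>x. tm_next (M x) (c x))"
proof -
  have e: "tm_next M c = (case map_of M (fst c, scanned (snd (snd c))) of
        None \<Rightarrow> None
      | Some r \<Rightarrow> Some (fst r, tm_move (snd (snd r)) (fst (snd c)) (fst (snd r) # tl (snd (snd c)))))" for M c
    by (cases c) (auto split: option.split)
  show ?thesis
    unfolding e by (intro pr_intros assms pr_comp[OF assms(2)])
qed

section \<open>Runs with a time bound\<close>

definition tm_step :: "tm \<Rightarrow> tm_config \<Rightarrow> tm_config" where
  "tm_step M c = (case tm_next M c of None \<Rightarrow> c | Some c' \<Rightarrow> c')"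

text \<open>Halted configurations are fixed points of \<open>tm_step\<close>, so a bounded run is a
  plain iteration and a result persists for all larger bounds.\<close>

definition output_within :: "tm \<Rightarrow> nat \<Rightarrow> nat \<Rightarrow> nat option" where
  "output_within M t n = (let c = (tm_step M ^^ t) (0, [], replicate n 1) in
     case tm_next M c of None \<Rightarrow> Some (length (takeWhile (\<lambda>a. a = 1) (snd (snd c)))) | Some _ \<Rightarrow> None)"

lemma pr_output_within [pr_intros]:
  assumes "pr M" "pr t" "pr n"
  shows "pr (\<lambda>x. output_within (M x) (t x) (n x))"
  unfolding output_within_def tm_step_def
  by (intro pr_intros assms pr_comp[OF assms(1)])

lemma tm_reaches_iff_tm_step:
  assumes "tm_next M c' = None"
  shows "tm_reaches M c c' \<longleftrightarrow> (\<exists>t. (tm_step M ^^ t) c = c')"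
proof
  assume "tm_reaches M c c'"
  then show "\<exists>t. (tm_step M ^^ t) c = c'"
    unfolding tm_reaches_def
  proof (induction rule: rtranclp_induct)
    case base
    show ?case by (rule exI[of _ 0]) simp
  next
    case (step c1 c2)
    then obtain t where "(tm_step M ^^ t) c = c1" by blast
    with step.hyps(2) have "(tm_step M ^^ Suc t) c = c2" by (simp add: tm_step_def)
    then show ?case by blast
  qed
next
  have "tm_reaches M c ((tm_step M ^^ t) c)" for t
  proof (induction t)
    case (Suc t)
    then show ?case
      unfolding tm_reaches_def
      by (auto simp: tm_step_def split: option.split intro: rtranclp.rtrancl_into_rtrancl)
  qed (simp add: tm_reaches_def)
  then show "\<exists>t. (tm_step M ^^ t) c = c' \<Longrightarrow> tm_reaches M c c'" by blast
qed

lemma output_within_Some_iff: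
  "output_within M t n = Some m \<longleftrightarrow>
     tm_next M ((tm_step M ^^ t) (0, [], replicate n 1)) = None \<and>
     m = length (takeWhile (\<lambda>a. a = 1) (snd (snd ((tm_step M ^^ t) (0, [], replicate n 1)))))"
  by (auto simp: output_within_def Let_def split: option.splits)

lemma tm_outputs_iff: "tm_outputs M n m \<longleftrightarrow> (\<exists>t. output_within M t n = Some m)"
proof
  assume "tm_outputs M n m"
  then obtain q ls rs where "tm_reaches M (0, [], replicate n 1) (q, ls, rs)"
    "tm_next M (q, ls, rs) = None" "m = length (takeWhile (\<lambda>a. a = 1) rs)"
    unfolding tm_outputs_def by blast
  then obtain t where "(tm_step M ^^ t) (0, [], replicate n 1) = (q, ls, rs)"
    using tm_reaches_iff_tm_step by blast
  then have "output_within M t n = Some m"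
    using \<open>tm_next M (q, ls, rs) = None\<close> \<open>m = length (takeWhile (\<lambda>a. a = 1) rs)\<close> by (simp add: output_within_Some_iff)
  then show "\<exists>t. output_within M t n = Some m" ..
next
  assume "\<exists>t. output_within M t n = Some m"
  then obtain t where t: "output_within M t n = Some m" by blast
  obtain q ls rs where c: "(tm_step M ^^ t) (0, [], replicate n 1) = (q, ls, rs)" by (rule prod_cases3)
  then have "tm_next M (q, ls, rs) = None" "m = length (takeWhile (\<lambda>a. a = 1) rs)"
    using t by (simp_all add: output_within_Some_iff)
  moreover from this c have "tm_reaches M (0, [], replicate n 1) (q, ls, rs)"
    using tm_reaches_iff_tm_step by blast
  ultimately show "tm_outputs M n m" unfolding tm_outputs_def by blast
qed

lemma output_within_mono:
  assumes "output_within M t n = Some m" "t \<le> t'"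
  shows "output_within M t' n = Some m"
proof -
  have halted: "tm_next M c = None \<Longrightarrow> (tm_step M ^^ k) c = c" for c k
    by (induction k) (auto simp: tm_step_def)
  obtain k where "t' = k + t" using assms(2) by (metis add.commute le_Suc_ex)
  then show ?thesis
    using assms(1) by (auto simp: output_within_Some_iff funpow_add halted)
qed

lemma tm_range_iff: "m \<in> tm_range M \<longleftrightarrow> (\<exists>i t. output_within M t i = Some m)"
  by (auto simp: tm_range_def tm_outputs_iff)

section \<open>Decidable relations and the class \<open>Pi02\<close>\<close>

lemma pr_computable: "pr g \<Longrightarrow> computable g"
  by (simp add: pr_nat_iff pr_nat_computable)

lemma Pi02I:
  fixes P :: "nat \<Rightarrow> 'b::bij_encodable \<Rightarrow> 'c::bij_encodable \<Rightarrow> bool"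
  assumes "pr (\<lambda>q. P (fst q) (fst (snd q)) (snd (snd q)))"
  shows "Pi02 {x. \<forall>y. \<exists>z. P x y z}"
proof -
  let ?D = "\<lambda>n. (fst (prod_decode n), decode (fst (prod_decode (snd (prod_decode n)))) :: 'b,
    decode (snd (prod_decode (snd (prod_decode n)))) :: 'c)"
  define R where "R = {n. P (fst (?D n)) (fst (snd (?D n))) (snd (snd (?D n)))}"
  have "pr ?D" by (intro pr_intros)
  from pr_comp[OF assms this] have "pr (\<lambda>n. n \<in> R)" by (simp add: R_def)
  then have "pr (\<lambda>n. if n \<in> R then 1 else 0 :: nat)" by (intro pr_intros)
  then have "decidable R" unfolding decidable_def by (rule pr_computable)
  moreover have "(\<forall>y. \<exists>z. P x y z) \<longleftrightarrow> (\<forall>y. \<exists>z. prod_encode (x, prod_encode (y, z)) \<in> R)" for x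
  proof -
    have "(\<forall>y. \<exists>z. prod_encode (x, prod_encode (y, z)) \<in> R) \<longleftrightarrow> (\<forall>y. \<exists>z. P x (decode y) (decode z))"
      by (simp add: R_def)
    also have "\<dots> \<longleftrightarrow> (\<forall>y. \<exists>z. P x y z)"
      by (metis decode_encode)
    finally show ?thesis by blast
  qed
  ultimately show ?thesis unfolding Pi02_def by (intro exI[of _ R]) simp
qed

text \<open>Takes the place of the s-m-n theorem: for a fixed program, the table depends primitive
  recursively on the built-in argument.\<close>

lemma pr_machine: "pr (\<lambda>x. machine K c x)"
  unfolding machine_def by (intro pr_intros)

section \<open>Refuting patterns\<close>

lemma vec_add_assoc: "vec_add (vec_add u v) w = vec_add u (vec_add v w)"
proof (induction u arbitrary: v w)
  case (Cons a u)
  then show ?case by (cases v; cases w) (auto simp: vec_add_def)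
qed (simp add: vec_add_def)

lemma vec_add_zero_right: "length u = d \<Longrightarrow> vec_add u (replicate d 0) = u"
  by (induction u arbitrary: d) (auto simp: vec_add_def)

lemma vec_add_zero_left: "length u = d \<Longrightarrow> vec_add (replicate d 0) u = u"
  by (induction u arbitrary: d) (auto simp: vec_add_def)

lemma vec_add_in_Zd: "u \<in> Zd d \<Longrightarrow> v \<in> Zd d \<Longrightarrow> vec_add u v \<in> Zd d"
  by (simp add: Zd_def vec_add_def)

text \<open>
  A proof system for ``\<open>q\<close> appears in no configuration of \<open>subshift d A F\<close>'', complete by
  compactness. Its derivations serve as existential witnesses, so no bound on the number of
  colourings of a box is needed.
\<close>

inductive refuted :: "nat \<Rightarrow> nat set \<Rightarrow> pattern set \<Rightarrow> (vec \<times> nat) list \<Rightarrow> bool" for d A F where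
  occurs: "p \<in> F \<Longrightarrow> u \<in> Zd d \<Longrightarrow> (\<And>s. s \<in> dom p \<Longrightarrow> map_of q (vec_add u s) = p s) \<Longrightarrow> refuted d A F q"
| split: "v \<in> Zd d \<Longrightarrow> (\<And>a. a \<in> A \<Longrightarrow> refuted d A F ((v, a) # q)) \<Longrightarrow> refuted d A F q"

lemma refuted_sound:
  assumes "refuted d A F q" "x \<in> subshift d A F"
  shows "\<not> appears d (map_of q) x"
  using assms(1)
proof (induction rule: refuted.induct)
  case (occurs p u q)
  show ?case
  proof
    assume "appears d (map_of q) x"
    then obtain w where w: "w \<in> Zd d" "\<And>s. s \<in> dom (map_of q) \<Longrightarrow> map_of q s = Some (x (vec_add w s))"
      by (auto simp: appears_def)
    have "p s = Some (x (vec_add (vec_add w u) s))" if "s \<in> dom p" for s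
    proof -
      have "vec_add u s \<in> dom (map_of q)" using occurs(3)[OF that] that by (metis domIff)
      then show ?thesis using w(2) occurs(3)[OF that] by (simp add: vec_add_assoc)
    qed
    then have "appears d p x"
      unfolding appears_def using vec_add_in_Zd[OF w(1) occurs(2)] by blast
    then show False using assms(2) occurs(1) by (auto simp: subshift_def)
  qed
next
  case (split v q)
  show ?case
  proof
    assume "appears d (map_of q) x"
    then obtain w where w: "w \<in> Zd d" "\<And>s. s \<in> dom (map_of q) \<Longrightarrow> map_of q s = Some (x (vec_add w s))"
      by (auto simp: appears_def)
    have "x (vec_add w v) \<in> A"
      using assms(2) vec_add_in_Zd[OF w(1) split(1)] by (auto simp: subshift_def configurations_def)
    moreover have "appears d (map_of ((v, x (vec_add w v)) # q)) x"
      unfolding appears_def using w by (auto intro!: bexI[of _ w])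
    ultimately show False using split.IH by blast
  qed
qed

text \<open>If every symbol at \<open>v\<close> led to a refutation, rule \<open>split\<close> would
  refute \<open>q\<close> itself; so some symbol survives.\<close>

lemma not_refuted_extend:
  assumes "\<not> refuted d A F q" "map_of q \<in> patterns d A"
  shows "\<exists>q'. \<not> refuted d A F q' \<and> map_of q' \<in> patterns d A \<and> map_of q \<subseteq>\<^sub>m map_of q' \<and>
    (v \<in> Zd d \<longrightarrow> v \<in> dom (map_of q'))"
proof (cases "v \<in> Zd d \<and> v \<notin> dom (map_of q)")
  case True
  then obtain a where a: "a \<in> A" "\<not> refuted d A F ((v, a) # q)"
    using assms(1) refuted.split[of v d A F q] by blast
  moreover have "ran (map_of ((v, a) # q)) \<subseteq> insert a (ran (map_of q))"
    by (auto simp: ran_def)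
  then have "map_of ((v, a) # q) \<in> patterns d A"
    using assms(2) a(1) True by (auto simp: patterns_def)
  moreover have "map_of q \<subseteq>\<^sub>m map_of ((v, a) # q)"
    using True by (auto simp: map_le_def)
  ultimately show ?thesis by (intro exI[of _ "(v, a) # q"]) auto
next
  case False
  then show ?thesis using assms by (intro exI[of _ q]) auto
qed

text \<open>Compactness: the cells are visited in the order of their codes, and each receives a
  symbol that keeps the pattern unrefuted. A forbidden pattern in the limit would occupy finitely
  many cells, hence occur at some finite stage, which rule \<open>occurs\<close> would
  refute.\<close>

lemma not_refuted_appears:
  assumes "\<not> refuted d A F q" "map_of q \<in> patterns d A" "F \<subseteq> patterns d A"
  shows "\<exists>x\<in>subshift d A F. appears d (map_of q) x"
proof -
  define good where "good q \<longleftrightarrow> \<not> refuted d A F q \<and> map_of q \<in> patterns d A" for q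
  define nxt where "nxt n q = (SOME q'. good q' \<and> map_of q \<subseteq>\<^sub>m map_of q' \<and>
      (decode n \<in> Zd d \<longrightarrow> decode n \<in> dom (map_of q')))" for n q
  have nxt: "good (nxt n q) \<and> map_of q \<subseteq>\<^sub>m map_of (nxt n q) \<and>
      (decode n \<in> Zd d \<longrightarrow> decode n \<in> dom (map_of (nxt n q)))" if "good q" for n q
    unfolding nxt_def
    by (rule someI_ex) (use not_refuted_extend[of d A F q] that in \<open>auto simp: good_def\<close>)
  define f where "f = rec_nat q nxt"
  have f: "f 0 = q" "f (Suc n) = nxt n (f n)" for n by (simp_all add: f_def)
  have good: "good (f n)" for n
    by (induction n) (use assms nxt in \<open>auto simp: f good_def\<close>)
  have mono: "n \<le> m \<Longrightarrow> map_of (f n) \<subseteq>\<^sub>m map_of (f m)" for n m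
    by (induction m rule: dec_induct) (use nxt[OF good] f in \<open>auto intro: map_le_trans\<close>)
  define x where "x v = (if v \<in> Zd d then the (map_of (f (Suc (encode v))) v) else undefined)" for v
  have x: "map_of (f m) v = Some (x v)" if "v \<in> Zd d" "Suc (encode v) \<le> m" for v m
  proof -
    have "v \<in> dom (map_of (f (Suc (encode v))))"
      using nxt[OF good, of "encode v" "encode v"] that(1) by (simp add: f)
    then have "map_of (f (Suc (encode v))) v = Some (x v)" using that(1) by (auto simp: x_def)
    then show ?thesis using mono[OF that(2)] by (metis domI map_le_def)
  qed
  have agree: "map_of (f n) v = Some (x v)" if "v \<in> dom (map_of (f n))" for n v
  proof -
    have v: "v \<in> Zd d" using good[of n] that by (auto simp: good_def patterns_def)
    have "map_of (f (max n (Suc (encode v)))) v = Some (x v)" using x[OF v] by simp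
    moreover have "map_of (f (max n (Suc (encode v)))) v = map_of (f n) v"
      using mono[of n "max n (Suc (encode v))"] that by (auto simp: map_le_def)
    ultimately show ?thesis by simp
  qed
  have "x \<in> configurations d A"
    unfolding configurations_def
  proof (rule PiE_I)
    fix v assume "v \<in> Zd d"
    then have "map_of (f (Suc (encode v))) v = Some (x v)" using x by simp
    then show "x v \<in> A" using good[of "Suc (encode v)"] by (auto simp: good_def patterns_def ran_def)
  qed (simp add: x_def)
  moreover have "\<not> appears d p x" if p: "p \<in> F" for p
  proof
    assume "appears d p x"
    then obtain u where u: "u \<in> Zd d" "\<And>s. s \<in> dom p \<Longrightarrow> p s = Some (x (vec_add u s))"
      by (auto simp: appears_def)
    have dom: "finite (dom p)" "dom p \<subseteq> Zd d" using p assms(3) by (auto simp: patterns_def)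
    \<comment> \<open>A stage at which all cells of the occurrence have been filled; if
      \<open>dom p\<close> is empty, any stage will do.\<close>
    define m where "m = Max ((\<lambda>s. Suc (encode (vec_add u s))) ` dom p)"
    have "map_of (f m) (vec_add u s) = p s" if "s \<in> dom p" for s
      using that dom u x[of "vec_add u s" m] vec_add_in_Zd[of u d s] by (auto simp: m_def)
    then have "refuted d A F (f m)" using refuted.occurs[OF p u(1)] by blast
    then show False using good by (simp add: good_def)
  qed
  moreover have "appears d (map_of q) x"
    unfolding appears_def
  proof (intro bexI[of _ "replicate d 0"] ballI)
    fix s assume s: "s \<in> dom (map_of q)"
    then have "length s = d" using assms(2) by (auto simp: patterns_def Zd_def)
    then show "map_of q s = Some (x (vec_add (replicate d 0) s))"
      using agree[of s 0] s by (simp add: f vec_add_zero_left)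
  qed (simp add: Zd_def)
  ultimately show ?thesis by (auto simp: subshift_def)
qed

lemma refuted_iff:
  assumes "map_of q \<in> patterns d A" "F \<subseteq> patterns d A"
  shows "refuted d A F q \<longleftrightarrow> (\<forall>x\<in>subshift d A F. \<not> appears d (map_of q) x)"
  using refuted_sound not_refuted_appears assms by blast

text \<open>Forbidden patterns using symbols outside \<open>A\<close> cannot appear in
  configurations over \<open>A\<close>, hence the intersection with \<open>patterns d A\<close>. A
  foreign symbol is tested as a one-cell pattern at the origin; since appearance allows
  translations, this covers every cell.\<close>

lemma subshift_subset_iff:
  assumes "F \<subseteq> patterns d A" "G \<subseteq> patterns d B"
  shows "subshift d A F \<subseteq> subshift d B G \<longleftrightarrow>
    (\<forall>q. map_of q \<in> G \<inter> patterns d A \<longrightarrow> refuted d A F q) \<and>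
    (\<forall>c\<in>A - B. refuted d A F [(replicate d 0, c)])" (is "?L \<longleftrightarrow> ?R1 \<and> ?R2")
proof
  have single: "map_of [(replicate d 0, c)] \<in> patterns d A" if "c \<in> A" for c
    using that by (auto simp: patterns_def Zd_def)
  {
    assume L: ?L
    have ?R1
    proof (intro allI impI)
      fix q assume q: "map_of q \<in> G \<inter> patterns d A"
      then have "\<forall>x\<in>subshift d A F. \<not> appears d (map_of q) x"
        using L by (auto simp: subshift_def)
      then show "refuted d A F q" using q assms(1) by (simp add: refuted_iff)
    qed
    moreover have ?R2
    proof
      fix c assume c: "c \<in> A - B"
      have "\<not> appears d (map_of [(replicate d 0, c)]) x" if "x \<in> subshift d A F" for x
      proof
        assume "appears d (map_of [(replicate d 0, c)]) x"
        then obtain u where u: "u \<in> Zd d" "x (vec_add u (replicate d 0)) = c"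
          by (auto simp: appears_def)
        have "x \<in> configurations d B" using that L by (auto simp: subshift_def)
        then have "x (vec_add u (replicate d 0)) \<in> B"
          using u(1) by (auto simp: configurations_def Zd_def vec_add_zero_right)
        then show False using u(2) c by simp
      qed
      then show "refuted d A F [(replicate d 0, c)]"
        using c single assms(1) refuted_iff[of "[(replicate d 0, c)]" d A F] by blast
    qed
    ultimately show "?R1 \<and> ?R2" by blast
  }
  assume R: "?R1 \<and> ?R2"
  show ?L
  proof
    fix x assume x: "x \<in> subshift d A F"
    then have xA: "x \<in> configurations d A" by (simp add: subshift_def)
    have "x \<in> configurations d B"
      unfolding configurations_def
    proof (rule PiE_I)
      fix v assume v: "v \<in> Zd d"
      then have "appears d (map_of [(replicate d 0, x v)]) x"
        by (auto simp: appears_def Zd_def vec_add_zero_right)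
      then have "\<not> refuted d A F [(replicate d 0, x v)]" using refuted_sound x by blast
      moreover have "x v \<in> A" using xA v by (auto simp: configurations_def)
      ultimately show "x v \<in> B" using R by blast
    next
      fix v assume "v \<notin> Zd d"
      then show "x v = undefined" using xA PiE_arb unfolding configurations_def by metis
    qed
    moreover have "\<not> appears d p x" if p: "p \<in> G" for p
    proof
      assume a: "appears d p x"
      have dom: "finite (dom p)" "dom p \<subseteq> Zd d" using p assms(2) by (auto simp: patterns_def)
      obtain u where u: "u \<in> Zd d" "\<And>s. s \<in> dom p \<Longrightarrow> p s = Some (x (vec_add u s))"
        using a by (auto simp: appears_def)
      have "ran p \<subseteq> A"
      proof
        fix c assume "c \<in> ran p"
        then obtain s where s: "p s = Some c" by (auto simp: ran_def)
        then have "s \<in> dom p" by blast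
        then have "c = x (vec_add u s)" "vec_add u s \<in> Zd d"
          using u(2) s dom(2) vec_add_in_Zd[OF u(1)] by auto
        then show "c \<in> A" using xA by (auto simp: configurations_def)
      qed
      then have pA: "p \<in> patterns d A" using dom by (simp add: patterns_def)
      obtain n where "pattern_of n = p" using pattern_of_surj[OF pA] by blast
      then obtain q where "map_of q = p" by (auto simp: pattern_of_def)
      then show False using R p pA a x refuted_sound by blast
    qed
    ultimately show "x \<in> subshift d B G" by (simp add: subshift_def)
  qed
qed

section \<open>Certificates of refutation\<close>

definition cells :: "nat \<Rightarrow> (vec \<times> nat) list" where
  "cells = decode"

lemma pattern_of_eq: "pattern_of n = map_of (cells n)"
proof -
  have "cells n = map (\<lambda>e. case prod_decode e of (v, a) \<Rightarrow> (map int_decode (list_decode v), a)) (list_decode n)"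
    unfolding cells_def
    by (rule decode_eqI)
      (simp add: encode_list_def encode_prod_def encode_int_def comp_def case_prod_beta)
  then show ?thesis by (simp add: pattern_of_def)
qed

text \<open>Looks up \<open>map_of L (fst e)\<close> instead of \<open>snd e\<close>, because later
  entries for a repeated position do not count.\<close>

definition valid_cells :: "nat \<Rightarrow> nat \<Rightarrow> (vec \<times> nat) list \<Rightarrow> bool" where
  "valid_cells d a L \<longleftrightarrow> (\<forall>e\<in>set L. length (fst e) = d \<and>
     (case map_of L (fst e) of None \<Rightarrow> True | Some b \<Rightarrow> b \<in> set_decode a))"

lemma valid_cells_iff: "valid_cells d a L \<longleftrightarrow> map_of L \<in> patterns d (set_decode a)"
proof -
  have "ran (map_of L) \<subseteq> A \<longleftrightarrow> (\<forall>e\<in>set L. case map_of L (fst e) of None \<Rightarrow> True | Some b \<Rightarrow> b \<in> A)" for A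
  proof
    assume "ran (map_of L) \<subseteq> A"
    then show "\<forall>e\<in>set L. case map_of L (fst e) of None \<Rightarrow> True | Some b \<Rightarrow> b \<in> A"
      by (auto split: option.split intro: ranI)
  next
    assume *: "\<forall>e\<in>set L. case map_of L (fst e) of None \<Rightarrow> True | Some b \<Rightarrow> b \<in> A"
    show "ran (map_of L) \<subseteq> A"
    proof
      fix b assume "b \<in> ran (map_of L)"
      then obtain k where "map_of L k = Some b" by (auto simp: ran_def)
      then show "b \<in> A" using * map_of_SomeD[of L k b] by force
    qed
  qed
  then show ?thesis
    by (auto simp: valid_cells_def patterns_def finite_dom_map_of dom_map_of_conv_image_fst Zd_def)
qed

type_synonym refutation_step = "(vec \<times> nat) list \<times> vec \<times> nat \<times> nat"

text \<open>The disjuncts check the rules \<open>split\<close> and \<open>occurs\<close>;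
  \<open>v\<close> is the cell to split in the former and the translation in the latter. The bound
  \<open>c < a\<close> makes the quantifier finite and loses nothing by
  \<open>set_decode_less\<close>.\<close>

definition step_ok :: "nat \<Rightarrow> nat \<Rightarrow> tm \<Rightarrow> (vec \<times> nat) list list \<Rightarrow> refutation_step \<Rightarrow> bool" where
  "step_ok d a M S r = (let q = fst r; v = fst (snd r); i = fst (snd (snd r)); t = snd (snd (snd r)) in
     length v = d \<and>
     ((\<forall>c<a. c \<in> set_decode a \<longrightarrow> (v, c) # q \<in> set S) \<or>
      (case output_within M t i of None \<Rightarrow> False | Some w \<Rightarrow> valid_cells d a (cells w) \<and>
         (\<forall>e\<in>set (cells w). map_of q (vec_add v (fst e)) = map_of (cells w) (fst e)))))"

text \<open>Incorrect steps are skipped, so every list is a sound certificate and certificates can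
  be concatenated.\<close>

definition refutations :: "nat \<Rightarrow> nat \<Rightarrow> tm \<Rightarrow> refutation_step list \<Rightarrow> (vec \<times> nat) list list" where
  "refutations d a M D = foldl (\<lambda>S r. if step_ok d a M S r then fst r # S else S) [] D"

lemma set_decode_less: "c \<in> set_decode a \<Longrightarrow> c < a"
proof -
  assume "c \<in> set_decode a"
  then have "set_decode (set_encode {c}) \<subseteq> set_decode a" by (subst set_encode_inverse) auto
  then have "2 ^ c \<le> a" using subset_decode_imp_le by fastforce
  then show ?thesis using less_exp[of c] by linarith
qed

lemma step_ok_iff:
  "step_ok d a M S (q, v, i, t) \<longleftrightarrow> v \<in> Zd d \<and>
     ((\<forall>c\<in>set_decode a. (v, c) # q \<in> set S) \<or>
      (\<exists>w. output_within M t i = Some w \<and> pattern_of w \<in> patterns d (set_decode a) \<and>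
         (\<forall>s\<in>dom (pattern_of w). map_of q (vec_add v s) = pattern_of w s)))"
  using set_decode_less
  by (auto simp: step_ok_def Zd_def valid_cells_iff pattern_of_eq dom_map_of_conv_image_fst split: option.splits)

lemma refutations_sound:
  "q \<in> set (refutations d a M D) \<Longrightarrow>
   refuted d (set_decode a) (enumerated_patterns d (set_decode a) M) q"
proof (induction D arbitrary: q rule: rev_induct)
  case (snoc r D)
  let ?F = "enumerated_patterns d (set_decode a) M"
  obtain q' v i t where r: "r = (q', v, i, t)" by (cases r) auto
  show ?case
  proof (cases "q \<in> set (refutations d a M D)")
    case False
    with snoc.prems have q: "q = q'" and ok: "step_ok d a M (refutations d a M D) (q, v, i, t)"
      by (auto simp: refutations_def r split: if_splits)
    from ok have v: "v \<in> Zd d" by (simp add: step_ok_iff)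
    from ok consider "\<forall>c\<in>set_decode a. (v, c) # q \<in> set (refutations d a M D)"
      | w where "output_within M t i = Some w" "pattern_of w \<in> patterns d (set_decode a)"
         "\<forall>s\<in>dom (pattern_of w). map_of q (vec_add v s) = pattern_of w s"
      unfolding step_ok_iff by blast
    then show ?thesis
    proof cases
      case 1
      then show ?thesis using snoc.IH refuted.split[OF v] by blast
    next
      case 2
      then have "pattern_of w \<in> ?F" unfolding enumerated_patterns_def tm_range_iff[symmetric] using tm_range_iff by blast
      then show ?thesis using refuted.occurs[OF _ v] 2(3) by blast
    qed
  qed (rule snoc.IH)
qed (simp add: refutations_def)

lemma step_ok_mono: "step_ok d a M S r \<Longrightarrow> set S \<subseteq> set S' \<Longrightarrow> step_ok d a M S' r"
  by (cases r) (auto simp: step_ok_iff)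

lemma foldl_steps_mono:
  "set S \<subseteq> set S' \<Longrightarrow> set (foldl (\<lambda>S r. if step_ok d a M S r then fst r # S else S) S D)
    \<subseteq> set (foldl (\<lambda>S r. if step_ok d a M S r then fst r # S else S) S' D)"
proof (induction D arbitrary: S S')
  case (Cons r D)
  then show ?case using step_ok_mono[OF _ Cons.prems, of d a M r] by (auto intro!: Cons.IH)
qed simp

lemma foldl_steps_extend:
  "set S \<subseteq> set (foldl (\<lambda>S r. if step_ok d a M S r then fst r # S else S) S D)"
proof (induction D arbitrary: S)
  case (Cons r D)
  show ?case
    using Cons[of S] Cons[of "fst r # S"] by auto
qed simp

lemma refutations_append:
  "set (refutations d a M D) \<union> set (refutations d a M D') \<subseteq> set (refutations d a M (D @ D'))"
  unfolding refutations_def foldl_append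
  using foldl_steps_extend foldl_steps_mono[of "[]"] by auto

text \<open>Finiteness of the alphabet enters here: the finitely many premises of
  \<open>split\<close> fit into one certificate.\<close>

lemma refutations_union:
  assumes "finite A" "\<And>c. c \<in> A \<Longrightarrow> \<exists>D. g c \<in> set (refutations d a M D)"
  shows "\<exists>D. \<forall>c\<in>A. g c \<in> set (refutations d a M D)"
  using assms
proof (induction rule: finite_induct)
  case (insert c A)
  then obtain D D' where "\<forall>c\<in>A. g c \<in> set (refutations d a M D)" "g c \<in> set (refutations d a M D')"
    by blast
  then show ?case using refutations_append[of d a M D D'] by (intro exI[of _ "D @ D'"]) blast
qed simp

lemma refutations_complete:
  assumes "refuted d (set_decode a) (enumerated_patterns d (set_decode a) M) q"
  shows "\<exists>D. q \<in> set (refutations d a M D)"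
  using assms
proof (induction rule: refuted.induct)
  case (occurs p u q)
  then obtain w i t where "p = pattern_of w" "p \<in> patterns d (set_decode a)" "output_within M t i = Some w"
    by (auto simp: enumerated_patterns_def tm_range_iff)
  then have "step_ok d a M [] (q, u, i, t)" using occurs(2,3) by (auto simp: step_ok_iff)
  then have "q \<in> set (refutations d a M [(q, u, i, t)])" by (simp add: refutations_def)
  then show ?case by blast
next
  case (split v q)
  then obtain D where "\<forall>c\<in>set_decode a. (v, c) # q \<in> set (refutations d a M D)"
    using refutations_union[OF finite_set_decode, of a "\<lambda>c. (v, c) # q"] by blast
  \<comment> \<open>Only the \<open>occurs\<close> alternative reads input and time bound, so
    \<open>0\<close> serves for both.\<close>
  then have "step_ok d a M (refutations d a M D) (q, v, 0, 0)"
    using split(1) by (simp add: step_ok_iff)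
  then have "q \<in> set (refutations d a M (D @ [(q, v, 0, 0)]))" by (simp add: refutations_def)
  then show ?case by blast
qed

lemma refuted_iff_refutations:
  "refuted d (set_decode a) (enumerated_patterns d (set_decode a) M) q \<longleftrightarrow>
     (\<exists>D. q \<in> set (refutations d a M D))"
  using refutations_sound refutations_complete by blast

section \<open>The inclusion problem is in \<open>\<Pi>\<^sup>0\<^sub>2\<close>\<close>

type_synonym raw_tm = "((nat \<times> nat) \<times> (nat \<times> nat \<times> nat)) list"

text \<open>Not every number codes a direction, so machines are decoded through raw tables.\<close>

definition valid_raw :: "raw_tm \<Rightarrow> bool" where
  "valid_raw m \<longleftrightarrow> (\<forall>e\<in>set m. snd (snd (snd e)) \<le> 1)"

definition tm_of_raw :: "raw_tm \<Rightarrow> tm" where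
  "tm_of_raw m = map (\<lambda>e. (fst e, fst (snd e), fst (snd (snd e)),
     if snd (snd (snd e)) = 0 then MoveL else MoveR)) m"

lemma encode_tm_of_raw: "valid_raw m \<Longrightarrow> encode (tm_of_raw m) = encode m"
  unfolding valid_raw_def tm_of_raw_def
  by (induction m) (auto simp: encode_prod_def encode_direction_def direction_encode_def le_Suc_eq)

lemma raw_tm_exists: "\<exists>m. valid_raw m \<and> encode m = encode M" for M :: tm
proof (induction M)
  case Nil
  show ?case by (rule exI[of _ "[]"]) (simp add: valid_raw_def)
next
  case (Cons e M)
  then obtain m where m: "valid_raw m" "encode m = encode M" by blast
  obtain q a q' b D where e: "e = ((q, a), (q', b, D))" by (metis prod.collapse)
  show ?case
    by (rule exI[of _ "((q, a), (q', b, direction_encode D)) # m"])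
      (use m in \<open>auto simp: e valid_raw_def encode_prod_def encode_direction_def direction_encode_def split: direction.split\<close>)
qed

lemma mem_inclusion_problem_iff:
  assumes "decode x = (a, m)"
  shows "x \<in> inclusion_problem d Y \<longleftrightarrow> valid_raw m \<and>
    subshift d (set_decode a) (enumerated_patterns d (set_decode a) (tm_of_raw m)) \<subseteq> Y"
proof -
  have x: "x = encode (a, m)" using encode_decode[of x, where 'a = "nat \<times> raw_tm"] assms by simp
  show ?thesis
  proof
    assume "x \<in> inclusion_problem d Y"
    then obtain A M where A: "x = instance_encode A M" "finite A"
      "subshift d A (enumerated_patterns d A M) \<subseteq> Y" by (auto simp: inclusion_problem_def)
    obtain m' where m': "valid_raw m'" "encode m' = encode M" using raw_tm_exists by blast
    have "a = set_encode A" "encode m = encode m'"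
      using x A(1) m'(2) by (simp_all add: instance_encode_def encode_tm)
    moreover from this have "m = m'" by simp
    moreover have "tm_of_raw m' = M" using encode_tm_of_raw[OF m'(1)] m'(2) by simp
    ultimately show "valid_raw m \<and>
      subshift d (set_decode a) (enumerated_patterns d (set_decode a) (tm_of_raw m)) \<subseteq> Y"
      using A m' by simp
  next
    assume *: "valid_raw m \<and>
      subshift d (set_decode a) (enumerated_patterns d (set_decode a) (tm_of_raw m)) \<subseteq> Y"
    then have "x = instance_encode (set_decode a) (tm_of_raw m)"
      using x encode_tm_of_raw[of m] by (simp add: instance_encode_def encode_tm)
    then show "x \<in> inclusion_problem d Y"
      using * by (simp add: instance_encode_in_inclusion_problem_iff)
  qed
qed

text \<open>Replaces all lists representing a pattern by the one list \<open>cells w\<close>. By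
  \<open>refuted_iff\<close> refutability depends only on the partial function represented.\<close>

lemma subshift_subset_enumerated_iff:
  assumes "F \<subseteq> patterns d A"
  shows "subshift d A F \<subseteq> subshift d B (enumerated_patterns d B N) \<longleftrightarrow>
    (\<forall>w\<in>tm_range N. pattern_of w \<in> patterns d B \<and> pattern_of w \<in> patterns d A \<longrightarrow> refuted d A F (cells w)) \<and>
    (\<forall>c\<in>A - B. refuted d A F [(replicate d 0, c)])"
proof -
  have "(\<forall>q. map_of q \<in> enumerated_patterns d B N \<inter> patterns d A \<longrightarrow> refuted d A F q) \<longleftrightarrow>
    (\<forall>w\<in>tm_range N. pattern_of w \<in> patterns d B \<and> pattern_of w \<in> patterns d A \<longrightarrow> refuted d A F (cells w))"
    (is "?L \<longleftrightarrow> ?R")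
  proof
    assume L: ?L
    show ?R
    proof (intro ballI impI)
      fix w assume "w \<in> tm_range N" "pattern_of w \<in> patterns d B \<and> pattern_of w \<in> patterns d A"
      then have "map_of (cells w) \<in> enumerated_patterns d B N \<inter> patterns d A"
        unfolding enumerated_patterns_def pattern_of_eq[symmetric] by blast
      then show "refuted d A F (cells w)" using L by blast
    qed
  next
    assume R: ?R
    show ?L
    proof (intro allI impI)
      fix q assume q: "map_of q \<in> enumerated_patterns d B N \<inter> patterns d A"
      then obtain w where w: "w \<in> tm_range N" "map_of q = pattern_of w" "pattern_of w \<in> patterns d B"
        by (auto simp: enumerated_patterns_def)
      then have "refuted d A F (cells w)" using R q by auto
      then show "refuted d A F q"
        using q w(2) assms refuted_iff[of q d A F] refuted_iff[of "cells w" d A F]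
        by (simp add: pattern_of_eq)
    qed
  qed
  then show ?thesis
    using subshift_subset_iff[OF assms, of "enumerated_patterns d B N" B]
    by (simp add: enumerated_patterns_def)
qed

text \<open>Both conjuncts of the criterion share one quantifier block: \<open>y\<close> bundles a
  symbol with a bounded run of \<open>N\<close>, and \<open>z\<close> holds a certificate for each.
  Ranging over inputs and time bounds rather than outputs keeps the premise decidable.\<close>

definition inclusion_witness ::
    "nat \<Rightarrow> nat \<Rightarrow> tm \<Rightarrow> nat \<Rightarrow> nat \<times> nat \<times> nat \<Rightarrow> refutation_step list \<times> refutation_step list \<Rightarrow> bool" where
  "inclusion_witness d b N x y z =
     (let a = fst (decode x :: nat \<times> raw_tm); m = snd (decode x :: nat \<times> raw_tm); M = tm_of_raw m;
        c = fst y; i = fst (snd y); t = snd (snd y)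
      in valid_raw m \<and>
         (case output_within N t i of None \<Rightarrow> True
          | Some w \<Rightarrow> valid_cells d b (cells w) \<and> valid_cells d a (cells w) \<longrightarrow>
              cells w \<in> set (refutations d a M (fst z))) \<and>
         (c \<in> set_decode a \<and> c \<notin> set_decode b \<longrightarrow>
            [(replicate d 0, c)] \<in> set (refutations d a M (snd z))))"

lemma pr_tm_of_raw [pr_intros]: "pr m \<Longrightarrow> pr (\<lambda>x. tm_of_raw (m x))"
  unfolding tm_of_raw_def by (intro pr_intros)

lemma pr_cells [pr_intros]: "pr w \<Longrightarrow> pr (\<lambda>x. cells (w x))"
  unfolding cells_def by (intro pr_intros)

lemma pr_vec_add [pr_intros]: "pr u \<Longrightarrow> pr v \<Longrightarrow> pr (\<lambda>x. vec_add (u x) (v x))"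
  unfolding vec_add_def by (intro pr_intros)

lemma pr_valid_cells [pr_intros]:
  assumes "pr a" "pr L"
  shows "pr (\<lambda>x. valid_cells d (a x) (L x))"
  unfolding valid_cells_def by (intro pr_intros assms pr_comp[OF assms(1)] pr_comp[OF assms(2)])

lemma pr_step_ok: "pr (\<lambda>p. step_ok d (fst p) (fst (snd p)) (fst (snd (snd p))) (snd (snd (snd p))))"
  unfolding step_ok_def Let_def by (intro pr_intros)

lemma pr_refutations [pr_intros]:
  assumes "pr a" "pr M" "pr D"
  shows "pr (\<lambda>x. refutations d (a x) (M x) (D x))"
proof -
  have "pr (\<lambda>q. step_ok d (a (fst q)) (M (fst q)) (fst (snd q)) (snd (snd q)))"
    using pr_comp[OF pr_step_ok, of "\<lambda>q. (a (fst q), M (fst q), fst (snd q), snd (snd q))" d]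
    by (simp add: pr_Pair pr_fst pr_snd pr_id pr_comp[OF assms(1)] pr_comp[OF assms(2)])
  then show ?thesis
    unfolding refutations_def by (intro pr_intros assms)
qed

lemma pr_inclusion_witness:
  "pr (\<lambda>q. inclusion_witness d b N (fst q) (fst (snd q)) (snd (snd q)))"
  unfolding inclusion_witness_def Let_def valid_raw_def by (intro pr_intros)

lemma inclusion_problem_iff_witness:
  assumes "finite B"
  shows "x \<in> inclusion_problem d (subshift d B (enumerated_patterns d B N)) \<longleftrightarrow>
    (\<forall>y. \<exists>z. inclusion_witness d (set_encode B) N x y z)"
proof -
  obtain a :: nat and m :: raw_tm where am: "decode x = (a, m)" by fastforce
  let ?A = "set_decode a" and ?M = "tm_of_raw m"
  let ?F = "enumerated_patterns d ?A ?M"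
  have B: "set_decode (set_encode B) = B" using assms by simp
  have F: "?F \<subseteq> patterns d ?A" by (simp add: enumerated_patterns_def)
  have w: "inclusion_witness d (set_encode B) N x (c, i, t) (D, D') \<longleftrightarrow> valid_raw m \<and>
     (\<forall>w. output_within N t i = Some w \<longrightarrow> pattern_of w \<in> patterns d B \<and> pattern_of w \<in> patterns d ?A \<longrightarrow>
        cells w \<in> set (refutations d a ?M D)) \<and>
     (c \<in> ?A - B \<longrightarrow> [(replicate d 0, c)] \<in> set (refutations d a ?M D'))" for c i t D D'
    by (auto simp: inclusion_witness_def Let_def am valid_cells_iff B pattern_of_eq split: option.split)
  have "(\<forall>y. \<exists>z. inclusion_witness d (set_encode B) N x y z) \<longleftrightarrow>
    (\<forall>c i t. \<exists>D D'. inclusion_witness d (set_encode B) N x (c, i, t) (D, D'))"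
    by (simp add: split_paired_All split_paired_Ex)
  also have "\<dots> \<longleftrightarrow> valid_raw m \<and>
     (\<forall>i t. \<exists>D. \<forall>w. output_within N t i = Some w \<longrightarrow> pattern_of w \<in> patterns d B \<and> pattern_of w \<in> patterns d ?A \<longrightarrow>
        cells w \<in> set (refutations d a ?M D)) \<and>
     (\<forall>c\<in>?A - B. \<exists>D. [(replicate d 0, c)] \<in> set (refutations d a ?M D))"
    unfolding w by blast
  also have "(\<forall>i t. \<exists>D. \<forall>w. output_within N t i = Some w \<longrightarrow> pattern_of w \<in> patterns d B \<and> pattern_of w \<in> patterns d ?A \<longrightarrow>
        cells w \<in> set (refutations d a ?M D)) \<longleftrightarrow>
     (\<forall>w\<in>tm_range N. pattern_of w \<in> patterns d B \<and> pattern_of w \<in> patterns d ?A \<longrightarrow>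
        (\<exists>D. cells w \<in> set (refutations d a ?M D)))"
  proof -
    \<comment> \<open>The certificate may be chosen before \<open>w\<close>, because
      \<open>r\<close> determines \<open>w\<close>.\<close>
    have *: "(\<exists>D. \<forall>w. r = Some w \<longrightarrow> \<Phi> w \<longrightarrow> \<Psi> D w) \<longleftrightarrow> (\<forall>w. r = Some w \<longrightarrow> \<Phi> w \<longrightarrow> (\<exists>D. \<Psi> D w))"
      for r :: "nat option" and \<Phi> and \<Psi> :: "refutation_step list \<Rightarrow> nat \<Rightarrow> bool"
      by (cases r) auto
    show ?thesis unfolding * Ball_def tm_range_iff by blast
  qed
  finally show ?thesis
    unfolding mem_inclusion_problem_iff[OF am] subshift_subset_enumerated_iff[OF F]
      refuted_iff_refutations by blast
qed

lemma Pi02_inclusion_problem: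
  assumes "finite B"
  shows "Pi02 (inclusion_problem d (subshift d B (enumerated_patterns d B N)))"
proof -
  have "inclusion_problem d (subshift d B (enumerated_patterns d B N)) =
      {x. \<forall>y. \<exists>z. inclusion_witness d (set_encode B) N x y z}"
    using inclusion_problem_iff_witness[OF assms] by blast
  then show ?thesis using Pi02I[OF pr_inclusion_witness] by simp
qed

section \<open>Hardness\<close>

text \<open>
  A number that codes no pattern on \<open>\<int>\<^sup>d\<close> for \<open>d \<ge> 1\<close>: it is output where a partial machine
  would diverge.
\<close>

definition junk :: nat where
  "junk = encode [([] :: vec, 0 :: nat)]"

lemma junk_not_pattern: "d \<ge> 1 \<Longrightarrow> pattern_of junk \<notin> patterns d A"
  by (simp add: pattern_of_eq cells_def junk_def patterns_def Zd_def del: encode_Cons)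

text \<open>The stage \<open>s\<close> bounds both the witnesses \<open>z\<close> and the running
  times, which makes the check finite.\<close>

definition approved :: "tm \<Rightarrow> nat \<Rightarrow> nat \<Rightarrow> nat \<Rightarrow> bool" where
  "approved M x i s \<longleftrightarrow>
     (\<forall>y<Suc i. \<exists>z<Suc s. output_within M s (prod_encode (x, prod_encode (y, z))) = Some 1)"

definition guarded_output :: "tm \<Rightarrow> tm \<Rightarrow> nat \<Rightarrow> nat \<Rightarrow> nat \<Rightarrow> nat" where
  "guarded_output N M x i s =
     (if approved M x i s then case output_within N s i of None \<Rightarrow> junk | Some w \<Rightarrow> w else junk)"

lemma pr_guarded_output:
  "pr (\<lambda>p. guarded_output N M (snd (prod_decode p))
     (fst (prod_decode (fst (prod_decode p)))) (snd (prod_decode (fst (prod_decode p)))))"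
  unfolding guarded_output_def approved_def by (intro pr_intros)

lemma enumerated_guarded:
  assumes "d \<ge> 1"
    and "\<And>n. tm_outputs G n (guarded_output N M x (fst (prod_decode n)) (snd (prod_decode n)))"
  shows "enumerated_patterns d B G =
    {pattern_of w |w i s. approved M x i s \<and> output_within N s i = Some w} \<inter> patterns d B"
proof -
  have "tm_range G = {guarded_output N M x i s |i s. True}"
  proof
    show "tm_range G \<subseteq> {guarded_output N M x i s |i s. True}"
      using tm_outputs_unique[OF _ assms(2)] by (auto simp: tm_range_def)
    have "guarded_output N M x i s \<in> tm_range G" for i s
      using assms(2)[of "prod_encode (i, s)"] by (auto simp: tm_range_def)
    then show "{guarded_output N M x i s |i s. True} \<subseteq> tm_range G" by blast
  qed
  then show ?thesis
    using junk_not_pattern[OF assms(1), of B]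
    by (auto simp: enumerated_patterns_def guarded_output_def split: if_splits option.splits) force
qed

text \<open>Arbitrarily late stages are needed so that the machine for \<open>Y\<close> has halted
  on \<open>i\<close> as well.\<close>

lemma approved_eventually:
  assumes "\<And>n. tm_outputs M n (if n \<in> R then 1 else 0)"
    and "\<forall>y. \<exists>z. prod_encode (x, prod_encode (y, z)) \<in> R"
  shows "\<exists>s\<ge>t. approved M x i s"
proof -
  have "\<forall>y. \<exists>z t. output_within M t (prod_encode (x, prod_encode (y, z))) = Some 1"
  proof
    fix y
    obtain z where "prod_encode (x, prod_encode (y, z)) \<in> R" using assms(2) by blast
    then have "tm_outputs M (prod_encode (x, prod_encode (y, z))) 1"
      using assms(1)[of "prod_encode (x, prod_encode (y, z))"] by simp
    then show "\<exists>z t. output_within M t (prod_encode (x, prod_encode (y, z))) = Some 1"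
      by (auto simp: tm_outputs_iff)
  qed
  then obtain zf tf where
    zt: "\<And>y. output_within M (tf y) (prod_encode (x, prod_encode (y, zf y))) = Some (1::nat)"
    by metis
  \<comment> \<open>The sum dominates each witness and each running time for
    \<open>y \<le> i\<close>, and also \<open>t\<close>.\<close>
  define s where "s = t + (\<Sum>y\<le>i. zf y + tf y)"
  have le: "zf y + tf y \<le> s" if "y \<le> i" for y
    using member_le_sum[of y "{..i}" "\<lambda>y. zf y + tf y"] that by (simp add: s_def)
  have "approved M x i s"
    unfolding approved_def
  proof (intro allI impI)
    fix y assume "y < Suc i"
    then have "zf y + tf y \<le> s" by (intro le) simp
    then show "\<exists>z<Suc s. output_within M s (prod_encode (x, prod_encode (y, z))) = Some 1"
      using output_within_mono[OF zt, of y s] by (intro exI[of _ "zf y"]) simp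
  qed
  then show ?thesis by (intro exI[of _ s]) (simp add: s_def)
qed

lemma approved_bounded:
  assumes "\<And>n. tm_outputs M n (if n \<in> R then 1 else 0)"
    and "\<And>z. prod_encode (x, prod_encode (y, z)) \<notin> R" "approved M x i s"
  shows "i < y"
proof (rule ccontr)
  assume "\<not> i < y"
  then obtain z where "output_within M s (prod_encode (x, prod_encode (y, z))) = Some 1"
    using assms(3) unfolding approved_def by (meson less_Suc_eq_le not_less)
  then have "tm_outputs M (prod_encode (x, prod_encode (y, z))) 1" by (auto simp: tm_outputs_iff)
  then show False
    using tm_outputs_unique assms(1)[of "prod_encode (x, prod_encode (y, z))"] assms(2)[of z] by fastforce
qed

lemma subshift_mono: "F \<subseteq> G \<Longrightarrow> subshift d A G \<subseteq> subshift d A F"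
  by (auto simp: subshift_def)

lemma hard_inclusion_problem:
  assumes "d \<ge> 1" "finite B" "\<not> SFT d (subshift d B (enumerated_patterns d B N))" "Pi02 Q"
  shows "many_one_reducible Q (inclusion_problem d (subshift d B (enumerated_patterns d B N)))"
proof -
  let ?F = "enumerated_patterns d B N"
  let ?Y = "subshift d B ?F"
  obtain R where R: "decidable R"
    "\<And>x. x \<in> Q \<longleftrightarrow> (\<forall>y. \<exists>z. prod_encode (x, prod_encode (y, z)) \<in> R)"
    using assms(4) by (auto simp: Pi02_def)
  obtain M where M: "\<And>n. tm_outputs M n (if n \<in> R then 1 else 0)"
    using R(1) by (auto simp: decidable_def computable_def)
  obtain K c where "\<And>n x. tm_outputs (machine K c x) n
      (guarded_output N M x (fst (prod_decode n)) (snd (prod_decode n)))"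
    using pr_nat_machine[OF pr_guarded_output[of N M, unfolded pr_nat_iff]] by auto
  then have G: "enumerated_patterns d B (machine K c x) =
      {pattern_of w |w i s. approved M x i s \<and> output_within N s i = Some w} \<inter> patterns d B" for x
    using enumerated_guarded[OF assms(1)] by blast
  have "pr (\<lambda>x. prod_encode (set_encode B, encode (machine K c x)))"
    by (intro pr_intros pr_machine)
  then have "computable (\<lambda>x. instance_encode B (machine K c x))"
    by (simp add: instance_encode_def encode_tm pr_computable)
  moreover have "x \<in> Q \<longleftrightarrow> instance_encode B (machine K c x) \<in> inclusion_problem d ?Y" for x
  proof
    assume "x \<in> Q"
    then have a: "\<exists>s\<ge>t. approved M x i s" for t i
      using approved_eventually[OF M] R(2) by blast
    have "?F \<subseteq> enumerated_patterns d B (machine K c x)"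
    proof
      fix p assume "p \<in> ?F"
      then obtain w i t where w: "p = pattern_of w" "p \<in> patterns d B" "output_within N t i = Some w"
        unfolding enumerated_patterns_def using tm_range_iff by blast
      obtain s where "s \<ge> t" "approved M x i s" using a by blast
      then show "p \<in> enumerated_patterns d B (machine K c x)"
        unfolding G using w output_within_mono by blast
    qed
    then show "instance_encode B (machine K c x) \<in> inclusion_problem d ?Y"
      using subshift_mono by (simp add: instance_encode_in_inclusion_problem_iff assms(2))
  next
    assume "instance_encode B (machine K c x) \<in> inclusion_problem d ?Y"
    then have sub: "subshift d B (enumerated_patterns d B (machine K c x)) \<subseteq> ?Y"
      by (simp add: instance_encode_in_inclusion_problem_iff assms(2))
    show "x \<in> Q"
    proof (rule ccontr)
      assume "x \<notin> Q"
      then obtain y where y: "\<And>z. prod_encode (x, prod_encode (y, z)) \<notin> R" using R(2) by blast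
      \<comment> \<open>Each input below \<open>y\<close> contributes at most one pattern, as
        outputs are unique; \<open>SOME\<close> names it.\<close>
      have fin: "enumerated_patterns d B (machine K c x) \<subseteq>
          (\<lambda>i. pattern_of (SOME w. tm_outputs N i w)) ` {..<y}"
      proof
        fix p assume "p \<in> enumerated_patterns d B (machine K c x)"
        then obtain w i s where w: "p = pattern_of w" "approved M x i s" "output_within N s i = Some w"
          unfolding G by blast
        have "tm_outputs N i w" using w(3) by (auto simp: tm_outputs_iff)
        then have "(SOME w. tm_outputs N i w) = w" using tm_outputs_unique by blast
        moreover have "i < y" using approved_bounded[OF M y w(2)] .
        ultimately show "p \<in> (\<lambda>i. pattern_of (SOME w. tm_outputs N i w)) ` {..<y}" using w(1) by auto
      qed
      have "enumerated_patterns d B (machine K c x) \<subseteq> ?F"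
      proof
        fix p assume "p \<in> enumerated_patterns d B (machine K c x)"
        then obtain w i s where w: "p = pattern_of w" "output_within N s i = Some w" "p \<in> patterns d B"
          unfolding G by blast
        then have "w \<in> tm_range N" by (auto simp: tm_range_iff)
        then show "p \<in> ?F" using w by (simp add: enumerated_patterns_def)
      qed
      then have "?Y = subshift d B (enumerated_patterns d B (machine K c x))"
        using sub subshift_mono by blast
      moreover have "finite (enumerated_patterns d B (machine K c x))"
        using fin finite_subset by blast
      ultimately have "SFT d ?Y"
        unfolding SFT_def using assms(2) by (metis enumerated_patterns_def inf_le2)
      then show False using assms(3) by blast
    qed
  qed
  ultimately show ?thesis unfolding many_one_reducible_def by blast
qed

theorem theorem6p2:
  fixes d :: nat and Y :: "configuration set"
  assumes "d \<ge> 1"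
    and "effective_subshift d Y"
    and "\<not> SFT d Y"
  shows "Pi02_complete (inclusion_problem d Y)"
proof -
  obtain B N where "finite B" "Y = subshift d B (enumerated_patterns d B N)"
    using assms(2) by (auto simp: effective_subshift_def)
  then show ?thesis
    using Pi02_inclusion_problem hard_inclusion_problem assms(1,3) by (simp add: Pi02_complete_def)
qed

end
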